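(* Let $D\subseteq\mathbb{R}^n$ be a generalized cone with exponent $p(D)>0$, and let $x\in D$. Then, as $t\to\infty$, $$P_x(\tau_D(Z)>t)\approx\begin{cases}t^{-p(D)},& p(D)<1,\\ t^{-1}\ln t,& p(D)=1,\\ t^{-(p(D)+1)/2},& p(D)>1.\end{cases}$$
   Context: $n$-dimensional iterated Brownian motion: let $X^+,X^-$ be independent $n$-dimensional Brownian motions from $0$, $Y$ an independent one-dimensional Brownian motion from $0$, $X_t=X^+_t$ ($t\ge0$), $X_t=X^-_{-t}$ ($t<0$), and $Z_t=x+X(Y_t)$ under $P_x$. For open $D$, $\tau_D(Z)=\inf\{t\ge0:Z_t\notin D\}$, and similarly $\tau_D(B)$ for $n$-dimensional Brownian motion $B$. A generalized cone is an open cone $D\subseteq\mathbb{R}^n$ with vertex $0$ such that $S^{n-1}\cap D$ is regular for the Dirichlet problem for the Laplace–Beltrami operator on $S^{n-1}$; for such $D$ there is $p(D)>0$ with $P_x(\tau_D(B)>t)\sim C(x)t^{-p(D)}$ as $t\to\infty$, $C(x)>0$. Notation: $f\approx g$ as $t\to\infty$ means there are constants $0<C_1\le C_2<\infty$ with $C_1\le f(t)/g(t)\le C_2$ for all sufficiently large $t$. *)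

theory Defs
  imports "HOL-Probability.Probability"
begin

definition open_cone_vertex0 :: "(real^'n) set \<Rightarrow> bool" where
  "open_cone_vertex0 D \<longleftrightarrow> open D \<and> (\<forall>x\<in>D. \<forall>c::real. c > 0 \<longrightarrow> c *\<^sub>R x \<in> D)"

definition dpart :: "'n \<Rightarrow> (real^'n \<Rightarrow> real) \<Rightarrow> real^'n \<Rightarrow> real" where
  "dpart i f x = deriv (\<lambda>h. f (x + h *\<^sub>R axis i 1)) 0"

definition has_dpart :: "'n \<Rightarrow> (real^'n \<Rightarrow> real) \<Rightarrow> real^'n \<Rightarrow> bool" where
  "has_dpart i f x \<longleftrightarrow> (\<lambda>h. f (x + h *\<^sub>R axis i 1)) differentiable (at 0)"

definition laplacian :: "(real^'n \<Rightarrow> real) \<Rightarrow> real^'n \<Rightarrow> real" where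
  "laplacian f x = (\<Sum>i\<in>UNIV. dpart i (dpart i f) x)"

definition C2_on :: "(real^'n) set \<Rightarrow> (real^'n \<Rightarrow> real) \<Rightarrow> bool" where
  "C2_on U f \<longleftrightarrow> continuous_on U f \<and>
     (\<forall>i. \<forall>x\<in>U. has_dpart i f x) \<and> (\<forall>i. continuous_on U (dpart i f)) \<and>
     (\<forall>i j. \<forall>x\<in>U. has_dpart i (dpart j f) x) \<and> (\<forall>i j. continuous_on U (dpart i (dpart j f)))"

definition harmonic_on :: "(real^'n) set \<Rightarrow> (real^'n \<Rightarrow> real) \<Rightarrow> bool" where
  "harmonic_on U f \<longleftrightarrow> open U \<and> C2_on U f \<and> (\<forall>x\<in>U. laplacian f x = 0)"

text \<open>Laplace--Beltrami harmonicity on a relatively open subset Om of the unit sphere: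
  the Laplace--Beltrami operator of u at a point of the sphere is the Euclidean Laplacian of
  the 0-homogeneous extension u(x/|x|); so u is Laplace--Beltrami harmonic on Om iff its
  0-homogeneous extension is harmonic on the open cone over Om.\<close>
definition cone_over :: "(real^'n) set \<Rightarrow> (real^'n) set" where
  "cone_over Om = {x. x \<noteq> 0 \<and> x /\<^sub>R norm x \<in> Om}"

definition LB_harmonic_on :: "(real^'n) set \<Rightarrow> (real^'n \<Rightarrow> real) \<Rightarrow> bool" where
  "LB_harmonic_on Om u \<longleftrightarrow> harmonic_on (cone_over Om) (\<lambda>x. u (x /\<^sub>R norm x))"

definition sphere_boundary :: "(real^'n) set \<Rightarrow> (real^'n) set" where
  "sphere_boundary Om = (sphere 0 1 \<inter> closure Om) - Om"

definition LB_dirichlet_regular :: "(real^'n) set \<Rightarrow> bool" where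
  "LB_dirichlet_regular Om \<longleftrightarrow>
     (\<forall>f. continuous_on (sphere_boundary Om) f \<longrightarrow>
        (\<exists>u. continuous_on (closure Om) u \<and> LB_harmonic_on Om u \<and>
             (\<forall>\<xi>\<in>sphere_boundary Om. u \<xi> = f \<xi>)))"

definition generalized_cone :: "(real^'n) set \<Rightarrow> bool" where
  "generalized_cone D \<longleftrightarrow> open_cone_vertex0 D \<and> LB_dirichlet_regular (sphere 0 1 \<inter> D)"

definition gauss_kernel :: "real \<Rightarrow> 'a::euclidean_space \<Rightarrow> real" where
  "gauss_kernel s y = (2 * pi * s) powr (- real DIM('a) / 2) * exp (- (norm y)\<^sup>2 / (2 * s))"

definition brownian_motion :: "'w measure \<Rightarrow> (real \<Rightarrow> 'w \<Rightarrow> 'a::euclidean_space) \<Rightarrow> bool" where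
  "brownian_motion M B \<longleftrightarrow> prob_space M \<and>
     (\<forall>t\<ge>0. B t \<in> borel_measurable M) \<and>
     (\<forall>\<omega>\<in>space M. B 0 \<omega> = 0 \<and> continuous_on {0..} (\<lambda>t. B t \<omega>)) \<and>
     (\<forall>s t. 0 \<le> s \<and> s < t \<longrightarrow>
        distributed M lborel (\<lambda>\<omega>. B t \<omega> - B s \<omega>) (\<lambda>y. ennreal (gauss_kernel (t - s) y))) \<and>
     (\<forall>ts. sorted_wrt (<) ts \<and> (\<forall>t\<in>set ts. 0 \<le> t) \<longrightarrow>
        prob_space.indep_vars M (\<lambda>_. borel) (\<lambda>i \<omega>. B (ts ! Suc i) \<omega> - B (ts ! i) \<omega>)
          {..<length ts - 1})"

definition path_space :: "(real \<Rightarrow> 'a::topological_space) measure" where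
  "path_space = Pi\<^sub>M {0::real..} (\<lambda>_. borel)"

definition path_of :: "(real \<Rightarrow> 'w \<Rightarrow> 'a) \<Rightarrow> 'w \<Rightarrow> real \<Rightarrow> 'a" where
  "path_of B \<omega> = restrict (\<lambda>t. B t \<omega>) {0..}"

definition indep3 :: "'w measure \<Rightarrow> (real \<Rightarrow> 'w \<Rightarrow> 'a::topological_space) \<Rightarrow>
    (real \<Rightarrow> 'w \<Rightarrow> 'a) \<Rightarrow> (real \<Rightarrow> 'w \<Rightarrow> 'b::topological_space) \<Rightarrow> bool" where
  "indep3 M Xp Xm Y \<longleftrightarrow>
     prob_space.indep_sets M
       (\<lambda>i::nat. if i = 0 then sets (vimage_algebra (space M) (path_of Xp) path_space)
                else if i = 1 then sets (vimage_algebra (space M) (path_of Xm) path_space)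
                else sets (vimage_algebra (space M) (path_of Y) path_space))
       {0, 1, 2}"

definition two_sided :: "(real \<Rightarrow> 'w \<Rightarrow> 'a) \<Rightarrow> (real \<Rightarrow> 'w \<Rightarrow> 'a) \<Rightarrow> real \<Rightarrow> 'w \<Rightarrow> 'a" where
  "two_sided Xp Xm r \<omega> = (if r \<ge> 0 then Xp r \<omega> else Xm (- r) \<omega>)"

definition iterated_bm :: "(real \<Rightarrow> 'w \<Rightarrow> 'a::plus) \<Rightarrow> (real \<Rightarrow> 'w \<Rightarrow> 'a) \<Rightarrow>
    (real \<Rightarrow> 'w \<Rightarrow> real) \<Rightarrow> 'a \<Rightarrow> real \<Rightarrow> 'w \<Rightarrow> 'a" where
  "iterated_bm Xp Xm Y x t \<omega> = x + two_sided Xp Xm (Y t \<omega>) \<omega>"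

text \<open>Exit time tau_D of a path: inf {t \<ge> 0. path t \<notin> D}, valued in the extended reals
  (infinite if the path never leaves D).\<close>
definition exit_time :: "'a set \<Rightarrow> (real \<Rightarrow> 'a) \<Rightarrow> ereal" where
  "exit_time D f = Inf (ereal ` {t. 0 \<le> t \<and> f t \<notin> D})"

definition approx_at_top :: "(real \<Rightarrow> real) \<Rightarrow> (real \<Rightarrow> real) \<Rightarrow> bool" where
  "approx_at_top f g \<longleftrightarrow> (\<exists>C1 C2. 0 < C1 \<and> C1 \<le> C2 \<and>
     (\<forall>\<^sub>F t in at_top. C1 \<le> f t / g t \<and> f t / g t \<le> C2))"

end

theory Submission
  imports Defs
begin

text \<open>
  Let \<open>S\<close> and \<open>I\<close> be the maxima of \<open>Y\<close> and \<open>- Y\<close> on \<open>[0, t]\<close>. Since \<open>Y\<close> is continuous, \<open>Z\<close>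
  stays in \<open>D\<close> up to time \<open>t\<close> iff \<open>Xp\<close> stays in \<open>D\<close> up to \<open>S\<close> and \<open>Xm\<close> up to \<open>I\<close>; by
  independence the survival probability is \<open>E (g S * g I)\<close>, where \<open>g u\<close> is comparable to
  \<open>u powr - p\<close> for \<open>u \<ge> 1\<close>. One of \<open>S\<close>, \<open>I\<close> is of order \<open>sqrt t\<close>, while the other one lies
  below \<open>a \<le> sqrt t\<close> with probability of order \<open>a / sqrt t\<close>. Splitting the smaller one into
  dyadic ranges, with \<open>2 ^ J\<close> comparable to \<open>sqrt t\<close>, gives the order of magnitude
  \<open>2 powr (- p * J) * (\<Sum>j\<le>J. 2 powr ((1 - p) * j)) / sqrt t\<close>, whose three regimes are the
  three cases of the theorem.

  The estimates on \<open>Y\<close> are proved on finite grids: the reflection principle (up to overshoots of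
  size one, which are harmless because only \<open>a \<ge> 1\<close> matters), the gambler's ruin estimate by
  optional stopping, and a small ball bound from finitely many independent increments.\<close>

section \<open>Brownian paths and their past\<close>

text \<open>The decay hypothesis concerns \<open>Xp\<close> alone. It passes to \<open>Xm\<close>
  because survival probabilities are limits of probabilities on finite grids, which depend only on
  the Gaussian increments. Grids also replace the strong Markov property: an exit at grid index k
  depends on finitely many earlier values, and the increment after it is independent of it. In the
  upper bound, the factor \<open>a / sqrt t\<close> for the smaller extremum is not enough: when the
  larger one is also below \<open>sqrt t\<close>, its survival weight is too big by a power with
  exponent p. The small ball bound supplies the compensating factor \<open>(b / sqrt t) ^ N\<close>;
  for \<open>N > p\<close> the double sum over dyadic ranges splits into a product with one
  geometric factor. In the lower bound, only the cumulative probabilities that the maximum stays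
  below \<open>2 ^ i\<close> are bounded from below, not those of single ranges; summation by parts
  converts the former into the weighted sum.\<close>

locale brownian = prob_space M for M :: "'w measure" +
  fixes B :: "real \<Rightarrow> 'w \<Rightarrow> 'a::euclidean_space"
  assumes bm: "brownian_motion M B"
begin

lemma rv [measurable]: "t \<ge> 0 \<Longrightarrow> B t \<in> borel_measurable M"
  and B_zero: "\<omega> \<in> space M \<Longrightarrow> B 0 \<omega> = 0"
  and B_cont: "\<omega> \<in> space M \<Longrightarrow> continuous_on {0..} (\<lambda>t. B t \<omega>)"
  and B_incr: "0 \<le> s \<Longrightarrow> s < t \<Longrightarrow>
        distributed M lborel (\<lambda>\<omega>. B t \<omega> - B s \<omega>) (\<lambda>y. ennreal (gauss_kernel (t - s) y))"
  and B_indep: "sorted_wrt (<) ts \<Longrightarrow> (\<And>t. t \<in> set ts \<Longrightarrow> 0 \<le> t) \<Longrightarrow>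
        indep_vars (\<lambda>_. borel) (\<lambda>i \<omega>. B (ts ! Suc i) \<omega> - B (ts ! i) \<omega>) {..<length ts - 1}"
  using bm unfolding brownian_motion_def by blast+

text \<open>Events determined by finitely many values suffice below, so that no monotone class argument for
  the natural filtration is needed.\<close>

definition past_event :: "real \<Rightarrow> 'w set \<Rightarrow> bool" where
  "past_event s A \<longleftrightarrow> (\<exists>T C. finite T \<and> T \<subseteq> {0..s} \<and> C \<in> sets (Pi\<^sub>M T (\<lambda>_. borel)) \<and>
     A = {\<omega> \<in> space M. restrict (\<lambda>u. B u \<omega>) T \<in> C})"

lemma past_event_mono: "past_event s A \<Longrightarrow> s \<le> t \<Longrightarrow> past_event t A"
  unfolding past_event_def by (elim exE conjE) (intro exI conjI, auto)

lemma past_event_single: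
  assumes "0 \<le> u" "u \<le> s" "C \<in> sets borel"
  shows "past_event s {\<omega> \<in> space M. B u \<omega> \<in> C}"
  unfolding past_event_def
proof (intro exI conjI)
  show "finite {u}" "{u} \<subseteq> {0..s}" using assms by auto
  show "{f \<in> space (Pi\<^sub>M {u} (\<lambda>_. borel)). f u \<in> C} \<in> sets (Pi\<^sub>M {u} (\<lambda>_. borel))"
    using assms(3) by measurable
  show "{\<omega> \<in> space M. B u \<omega> \<in> C} =
    {\<omega> \<in> space M. restrict (\<lambda>u. B u \<omega>) {u} \<in> {f \<in> space (Pi\<^sub>M {u} (\<lambda>_. borel)). f u \<in> C}}"
    by (auto simp: space_PiM)
qed

lemma past_event_Int:
  assumes "past_event s A1" "past_event s A2"
  shows "past_event s (A1 \<inter> A2)"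
proof -
  obtain T1 C1 where 1: "finite T1" "T1 \<subseteq> {0..s}" "C1 \<in> sets (Pi\<^sub>M T1 (\<lambda>_. borel))"
     "A1 = {\<omega> \<in> space M. restrict (\<lambda>u. B u \<omega>) T1 \<in> C1}" using assms unfolding past_event_def by blast
  obtain T2 C2 where 2: "finite T2" "T2 \<subseteq> {0..s}" "C2 \<in> sets (Pi\<^sub>M T2 (\<lambda>_. borel))"
     "A2 = {\<omega> \<in> space M. restrict (\<lambda>u. B u \<omega>) T2 \<in> C2}" using assms unfolding past_event_def by blast
  let ?T = "T1 \<union> T2"
  let ?P = "PiM ?T (\<lambda>_. borel :: 'a measure)"
  let ?C = "((\<lambda>f. restrict f T1) -` C1 \<inter> space ?P) \<inter> ((\<lambda>f. restrict f T2) -` C2 \<inter> space ?P)"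
  have "?C \<in> sets ?P"
    using 1(3) 2(3) by (intro sets.Int measurable_sets measurable_restrict_subset) auto
  moreover have "A1 \<inter> A2 = {\<omega> \<in> space M. restrict (\<lambda>u. B u \<omega>) ?T \<in> ?C}"
    unfolding 1(4) 2(4) by (auto simp: space_PiM Int_absorb1 Int_absorb2)
  ultimately show ?thesis
    unfolding past_event_def using 1 2 by (intro exI[of _ ?T] exI[of _ ?C]) auto
qed

lemma past_event_Ball:
  assumes "finite I" "0 \<le> s" "\<And>i. i \<in> I \<Longrightarrow> past_event s {\<omega> \<in> space M. P i \<omega>}"
  shows "past_event s {\<omega> \<in> space M. \<forall>i\<in>I. P i \<omega>}"
  using assms(1,3)
proof (induction I)
  case empty
  show ?case using past_event_single[of 0 s UNIV] assms(2) by simp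
next
  case (insert i I)
  have "{\<omega> \<in> space M. \<forall>i\<in>insert i I. P i \<omega>} = {\<omega> \<in> space M. P i \<omega>} \<inter> {\<omega> \<in> space M. \<forall>i\<in>I. P i \<omega>}" by auto
  thus ?case using insert by (auto intro!: past_event_Int)
qed

lemma past_event_sets: "past_event s A \<Longrightarrow> A \<in> sets M"
proof -
  assume "past_event s A"
  then obtain T C where 1: "finite T" "T \<subseteq> {0..s}" "C \<in> sets (Pi\<^sub>M T (\<lambda>_. borel))"
     "A = {\<omega> \<in> space M. restrict (\<lambda>u. B u \<omega>) T \<in> C}" unfolding past_event_def by blast
  have "(\<lambda>\<omega>. restrict (\<lambda>u. B u \<omega>) T) \<in> M \<rightarrow>\<^sub>M Pi\<^sub>M T (\<lambda>_. borel)"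
    using 1(2) by (intro measurable_restrict rv) auto
  moreover have "A = (\<lambda>\<omega>. restrict (\<lambda>u. B u \<omega>) T) -` C \<inter> space M" unfolding 1(4) by blast
  ultimately show ?thesis using measurable_sets[OF _ 1(3)] by metis
qed

text \<open>Adding 0, s and t to the observation times and sorting them expresses the observed
  values as partial sums of successive increments. The event then depends on the first
  \<open>m\<close> increments only, while increment number \<open>m\<close> is
  \<open>B t - B s\<close>.\<close>

lemma past_event_increments:
  assumes "past_event s A" "0 \<le> s" "s < t"
  obtains m X E where "indep_vars (\<lambda>_. borel) X {..m}" "E \<in> sets (Pi\<^sub>M {..<m} (\<lambda>_. borel))"
    "A = {\<omega> \<in> space M. restrict (\<lambda>i. X i \<omega>) {..<m :: nat} \<in> E}" "X m = (\<lambda>\<omega>. B t \<omega> - B s \<omega>)"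
proof -
  obtain T C where T: "finite T" "T \<subseteq> {0..s}" "C \<in> sets (Pi\<^sub>M T (\<lambda>_. borel))"
     "A = {\<omega> \<in> space M. restrict (\<lambda>u. B u \<omega>) T \<in> C}" using assms(1) unfolding past_event_def by blast
  \<comment> \<open>With 0 as first time the partial sums start from \<open>B 0 = 0\<close>; with s
    as last time the next increment starts exactly at s.\<close>
  define l where "l = sorted_list_of_set (insert 0 (insert s T))"
  have set_l: "set l = insert 0 (insert s T)" unfolding l_def by (rule set_sorted_list_of_set) (use T(1) in simp)
  have srt: "sorted_wrt (<) l" unfolding l_def by (rule strict_sorted_list_of_set)
  have ne: "l \<noteq> []" using set_l by auto
  define m where "m = length l - 1"
  have len: "length l = Suc m" using ne by (simp add: m_def)
  define ts where "ts = l @ [t]"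
  have srt': "sorted_wrt (<) ts"
    unfolding ts_def sorted_wrt_append using srt set_l assms T(2) by force
  have l_mono: "l ! i < l ! j" if "i < j" "j \<le> m" for i j
    using srt that len by (simp add: sorted_wrt_nth_less)
  have l0: "l ! 0 = 0"
  proof -
    obtain i where i: "i \<le> m" "l ! i = 0" using set_l len
      by (metis in_set_conv_nth insertI1 less_Suc_eq_le)
    have "l ! 0 \<in> set l" using len by simp
    hence "l ! 0 \<ge> 0" using set_l assms T(2) by auto
    thus ?thesis using i l_mono[of 0 i] by (cases "i = 0") auto
  qed
  have lm: "l ! m = s"
  proof -
    obtain i where i: "i \<le> m" "l ! i = s" using set_l len
      by (metis in_set_conv_nth insertI1 insertI2 less_Suc_eq_le)
    have "l ! m \<in> set l" using len by simp
    hence "l ! m \<le> s" using set_l assms T(2) by auto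
    thus ?thesis using i l_mono[of i m] by (cases "i = m") auto
  qed
  define inc where "inc = (\<lambda>i \<omega>. B (ts ! Suc i) \<omega> - B (ts ! i) \<omega>)"
  have "indep_vars (\<lambda>_. borel) inc {..<length ts - 1}"
    unfolding inc_def by (rule B_indep[OF srt']) (use set_l assms T(2) in \<open>auto simp: ts_def\<close>)
  hence ind: "indep_vars (\<lambda>_. borel) inc {..m}"
    by (simp add: ts_def len lessThan_Suc_atMost)
  have "\<exists>idx. \<forall>u\<in>T. idx u \<le> m \<and> l ! idx u = u"
    using set_l len by (intro bchoice) (metis in_set_conv_nth insertI2 less_Suc_eq_le)
  then obtain idx where idx: "\<And>u. u \<in> T \<Longrightarrow> idx u \<le> m" "\<And>u. u \<in> T \<Longrightarrow> l ! idx u = u" by blast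
  define Y1 where "Y1 = (\<lambda>f :: nat \<Rightarrow> 'a. restrict (\<lambda>u. \<Sum>i<idx u. f i) T)"
  have Y1: "Y1 \<in> PiM {..<m} (\<lambda>_. borel) \<rightarrow>\<^sub>M PiM T (\<lambda>_. borel)"
    unfolding Y1_def
  proof (rule measurable_restrict)
    fix u assume "u \<in> T"
    show "(\<lambda>f. \<Sum>i<idx u. f i) \<in> PiM {..<m} (\<lambda>_. borel) \<rightarrow>\<^sub>M (borel :: 'a measure)"
      using idx(1)[OF \<open>u \<in> T\<close>] by (intro borel_measurable_sum measurable_component_singleton) auto
  qed
  have tele: "(\<Sum>i<k. inc i \<omega>) = B (l ! k) \<omega>" if "\<omega> \<in> space M" "k \<le> m" for k \<omega>
    using that(2)
  proof (induction k)
    case 0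
    then show ?case using that l0 B_zero by simp
  next
    case (Suc k)
    then show ?case by (simp add: inc_def ts_def nth_append len)
  qed
  have e1: "Y1 (restrict (\<lambda>i. inc i \<omega>) {..<m}) = restrict (\<lambda>u. B u \<omega>) T"
    if "\<omega> \<in> space M" for \<omega>
  proof -
    have "(\<Sum>i<idx u. restrict (\<lambda>i. inc i \<omega>) {..<m} i) = B u \<omega>" if "u \<in> T" for u
      using tele[OF \<open>\<omega> \<in> space M\<close> idx(1)[OF that]] idx[OF that] by simp
    thus ?thesis by (auto simp: Y1_def)
  qed
  show ?thesis
  proof (rule that)
    show "indep_vars (\<lambda>_. borel) inc {..m}" by (rule ind)
    show "Y1 -` C \<inter> space (Pi\<^sub>M {..<m} (\<lambda>_. borel)) \<in> sets (Pi\<^sub>M {..<m} (\<lambda>_. borel))"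
      by (rule measurable_sets[OF Y1 T(3)])
    show "A = {\<omega> \<in> space M. restrict (\<lambda>i. inc i \<omega>) {..<m} \<in> Y1 -` C \<inter> space (Pi\<^sub>M {..<m} (\<lambda>_. borel))}"
      unfolding T(4) using e1 by (auto simp: space_PiM)
    show "inc m = (\<lambda>\<omega>. B t \<omega> - B s \<omega>)"
      using lm by (auto simp: inc_def ts_def nth_append len fun_eq_iff)
  qed
qed

text \<open>Independence of the blocks \<open>{..<m}\<close> and \<open>{m}\<close> of increments
  carries over to functions of them. The form with an indicator and a function f serves both
  probabilities and, with f the identity, the mean-zero property behind optional stopping.\<close>

lemma past_event_indep_var:
  assumes "past_event s A" "0 \<le> s" "s < t" "f \<in> borel_measurable borel"
  shows "indep_var borel (indicator A :: 'w \<Rightarrow> real) borel (\<lambda>\<omega>. f (B t \<omega> - B s \<omega>) :: real)"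
proof -
  obtain m X E where X: "indep_vars (\<lambda>_. borel) X {..m}" "E \<in> sets (Pi\<^sub>M {..<m} (\<lambda>_. borel))"
    "A = {\<omega> \<in> space M. restrict (\<lambda>i. X i \<omega>) {..<m :: nat} \<in> E}" "X m = (\<lambda>\<omega>. B t \<omega> - B s \<omega>)"
    by (rule past_event_increments[OF assms(1-3)])
  have "indep_var (PiM {..<m} (\<lambda>_. borel)) (\<lambda>\<omega>. restrict (\<lambda>i. X i \<omega>) {..<m})
      (PiM {m} (\<lambda>_. borel)) (\<lambda>\<omega>. restrict (\<lambda>i. X i \<omega>) {m})"
    by (rule indep_var_restrict[OF X(1)]) auto
  hence "indep_var borel (indicator E \<circ> (\<lambda>\<omega>. restrict (\<lambda>i. X i \<omega>) {..<m}) :: 'w \<Rightarrow> real)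
      borel ((\<lambda>g. f (g m)) \<circ> (\<lambda>\<omega>. restrict (\<lambda>i. X i \<omega>) {m}))"
    by (rule indep_var_compose) (intro borel_measurable_indicator X(2), intro measurable_compose[OF _ assms(4)] measurable_component_singleton, simp)
  hence D: "indep_var borel (indicator E \<circ> (\<lambda>\<omega>. restrict (\<lambda>i. X i \<omega>) {..<m}) :: 'w \<Rightarrow> real)
      borel (\<lambda>\<omega>. f (B t \<omega> - B s \<omega>))" by (simp add: o_def X(4))
  \<comment> \<open>The two indicators are compared only on \<open>space M\<close>, so independence
    is carried over through its characterisation by distributions.\<close>
  have eq: "(indicator E \<circ> (\<lambda>\<omega>. restrict (\<lambda>i. X i \<omega>) {..<m})) \<omega> = (indicator A \<omega> :: real)" 
    if "\<omega> \<in> space M" for \<omega> using that by (simp add: X(3) indicator_def)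
  have A: "(indicator A :: 'w \<Rightarrow> real) \<in> borel_measurable M" using past_event_sets[OF assms(1)] by simp
  have d1: "distr M borel (indicator E \<circ> (\<lambda>\<omega>. restrict (\<lambda>i. X i \<omega>) {..<m}) :: 'w \<Rightarrow> real)
    = distr M borel (indicator A)" by (rule distr_cong[OF refl refl eq])
  have d2: "distr M (borel \<Otimes>\<^sub>M borel) (\<lambda>\<omega>. ((indicator E \<circ> (\<lambda>\<omega>. restrict (\<lambda>i. X i \<omega>) {..<m})) \<omega> :: real, f (B t \<omega> - B s \<omega>)))
    = distr M (borel \<Otimes>\<^sub>M borel) (\<lambda>\<omega>. (indicator A \<omega>, f (B t \<omega> - B s \<omega>)))"
    by (rule distr_cong[OF refl refl]) (simp add: eq del: o_apply)
  note D1 = D[unfolded indep_var_distribution_eq, THEN conjunct2, THEN conjunct1]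
    and D2 = D[unfolded indep_var_distribution_eq, THEN conjunct2, THEN conjunct2]
  show ?thesis
    unfolding indep_var_distribution_eq using A D1 D2[unfolded d1 d2] by (intro conjI)
qed

lemma past_event_indep:
  assumes "past_event s A" "0 \<le> s" "s < t" "C \<in> sets borel"
  shows "prob (A \<inter> {\<omega> \<in> space M. B t \<omega> - B s \<omega> \<in> C}) = prob A * prob {\<omega> \<in> space M. B t \<omega> - B s \<omega> \<in> C}"
proof -
  have iv: "indep_var borel (indicator A :: 'w \<Rightarrow> real) borel (\<lambda>\<omega>. indicator C (B t \<omega> - B s \<omega>) :: real)"
    by (rule past_event_indep_var[OF assms(1-3) borel_measurable_indicator[OF assms(4)]])
  have "A \<subseteq> space M" using past_event_sets[OF assms(1)] sets.sets_into_space by blast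
  hence "(indicator A :: 'w \<Rightarrow> real) -` {1} \<inter> space M = A"
    "(\<lambda>\<omega>. indicator C (B t \<omega> - B s \<omega>) :: real) -` {1} \<inter> space M = {\<omega> \<in> space M. B t \<omega> - B s \<omega> \<in> C}"
    "(\<lambda>\<omega>. (indicator A \<omega>, indicator C (B t \<omega> - B s \<omega>)) :: real \<times> real) -` ({1} \<times> {1}) \<inter> space M = A \<inter> {\<omega> \<in> space M. B t \<omega> - B s \<omega> \<in> C}"
    by (auto simp: indicator_def split: if_splits)
  with indep_varD[OF iv, of "{1}" "{1}"] show ?thesis by simp
qed

end

lemma brownianI: "brownian_motion M B \<Longrightarrow> brownian M B"
  unfolding brownian_def brownian_axioms_def brownian_motion_def by blast

section \<open>Estimates for one-dimensional Brownian motion on grids\<close>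

context prob_space
begin

text \<open>The density is at most \<open>1 / (2 * \<sigma>)\<close> because
  \<open>sqrt (2 * pi) \<ge> 2\<close>, and the interval has length \<open>2 * r\<close>.\<close>

lemma normal_prob_abs_le:
  assumes X: "distributed M lborel X (normal_density 0 \<sigma>)" and "\<sigma> > 0" "r \<ge> 0"
  shows "prob {\<omega> \<in> space M. \<bar>X \<omega>\<bar> \<le> r} \<le> r / \<sigma>"
proof -
  have sq: "sqrt (2 * pi) \<ge> 2" using pi_ge_two by (intro real_le_rsqrt) auto
  have le: "normal_density 0 \<sigma> y \<le> 1 / (2 * \<sigma>)" for y
  proof -
    have "normal_density 0 \<sigma> y \<le> 1 / (sqrt (2 * pi) * \<sigma>) * 1"
      unfolding normal_density_def using assms by (intro mult_mono) (auto simp: real_sqrt_mult)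
    also have "\<dots> \<le> 1 / (2 * \<sigma>)"
      using assms sq by (auto intro!: divide_left_mono mult_right_mono)
    finally show ?thesis .
  qed
  have "emeasure M (X -` {-r..r} \<inter> space M) = (\<integral>\<^sup>+x. ennreal (normal_density 0 \<sigma> x) * indicator {-r..r} x \<partial>lborel)"
    by (rule distributed_emeasure[OF X]) simp
  also have "\<dots> \<le> (\<integral>\<^sup>+x. ennreal (1 / (2 * \<sigma>)) * indicator {-r..r} x \<partial>lborel)"
    by (intro nn_integral_mono mult_right_mono ennreal_leI le) auto
  also have "\<dots> = ennreal (1 / (2 * \<sigma>)) * ennreal (2 * r)"
    using assms by (simp add: nn_integral_cmult_indicator)
  also have "\<dots> = ennreal (r / \<sigma>)"
    using assms by (simp add: ennreal_mult[symmetric])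
  finally have "ennreal (prob (X -` {-r..r} \<inter> space M)) \<le> ennreal (r / \<sigma>)"
    by (simp add: emeasure_eq_measure)
  moreover have "X -` {-r..r} \<inter> space M = {\<omega> \<in> space M. \<bar>X \<omega>\<bar> \<le> r}" by auto
  ultimately show ?thesis using assms by (simp add: ennreal_le_iff)
qed

text \<open>For \<open>r \<le> \<sigma>\<close> the density on the interval is at least
  \<open>1 / (6 * \<sigma>)\<close>, as \<open>exp (- (1 / 2)) \<ge> 1 / 2\<close> and
  \<open>sqrt (2 * pi) \<le> 3\<close>.\<close>

lemma normal_prob_abs_ge:
  assumes X: "distributed M lborel X (normal_density 0 \<sigma>)" and "\<sigma> > 0" "0 \<le> r" "r \<le> \<sigma>"
  shows "prob {\<omega> \<in> space M. \<bar>X \<omega>\<bar> \<le> r} \<ge> r / (3 * \<sigma>)"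
proof -
  have sq: "sqrt (2 * pi) \<le> 3" using pi_less_4 by (intro real_le_lsqrt) auto
  have ge: "normal_density 0 \<sigma> y \<ge> 1 / (6 * \<sigma>)" if "\<bar>y\<bar> \<le> r" for y
  proof -
    have "y\<^sup>2 \<le> \<sigma>\<^sup>2" using that assms by (intro power2_le_iff_abs_le[THEN iffD2]) auto
    hence "- (1/2) \<le> - y\<^sup>2 / (2 * \<sigma>\<^sup>2)" using assms by (simp add: field_simps)
    hence "1 + - (1/2) \<le> exp (- y\<^sup>2 / (2 * \<sigma>\<^sup>2))"
      using exp_ge_add_one_self[of "- (1/2)"] by (meson exp_le_cancel_iff order_trans)
    hence 1: "1/2 \<le> exp (- y\<^sup>2 / (2 * \<sigma>\<^sup>2))" by simp
    have 2: "1 / (3 * \<sigma>) \<le> 1 / (sqrt (2 * pi) * \<sigma>)" 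
      using assms sq by (intro divide_left_mono mult_right_mono) auto
    have "1 / (3 * \<sigma>) * (1/2) \<le> 1 / (sqrt (2 * pi) * \<sigma>) * exp (- y\<^sup>2 / (2 * \<sigma>\<^sup>2))"
      by (rule mult_mono[OF 2 1]) (use assms in auto)
    also have "\<dots> = normal_density 0 \<sigma> y"
      unfolding normal_density_def using assms by (auto simp: real_sqrt_mult)
    finally show ?thesis by simp
  qed
  have "ennreal (r / (3 * \<sigma>)) = ennreal (1 / (6 * \<sigma>)) * ennreal (2 * r)"
    using assms by (simp add: ennreal_mult[symmetric])
  also have "\<dots> = (\<integral>\<^sup>+x. ennreal (1 / (6 * \<sigma>)) * indicator {-r..r} x \<partial>lborel)"
    using assms by (simp add: nn_integral_cmult_indicator)
  also have "\<dots> \<le> (\<integral>\<^sup>+x. ennreal (normal_density 0 \<sigma> x) * indicator {-r..r} x \<partial>lborel)"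
    by (intro nn_integral_mono) (auto simp: indicator_def intro!: ennreal_leI ge)
  also have "\<dots> = emeasure M (X -` {-r..r} \<inter> space M)"
    by (rule distributed_emeasure[OF X, symmetric]) simp
  finally have "ennreal (r / (3 * \<sigma>)) \<le> ennreal (prob (X -` {-r..r} \<inter> space M))"
    by (simp add: emeasure_eq_measure)
  moreover have "X -` {-r..r} \<inter> space M = {\<omega> \<in> space M. \<bar>X \<omega>\<bar> \<le> r}" by auto
  ultimately show ?thesis using assms by (simp add: ennreal_le_iff)
qed

lemma normal_symmetric:
  assumes X: "distributed M lborel X (normal_density 0 \<sigma>)" and "\<sigma> > 0" "C \<in> sets borel"
  shows "prob {\<omega> \<in> space M. - X \<omega> \<in> C} = prob {\<omega> \<in> space M. X \<omega> \<in> C}"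
proof -
  have Y: "distributed M lborel (\<lambda>\<omega>. - X \<omega>) (normal_density 0 \<sigma>)"
    using normal_density_affine[OF X, of "-1" 0] assms by simp
  have "C \<in> sets lborel" using assms by simp
  hence "emeasure M (X -` C \<inter> space M) = emeasure M ((\<lambda>\<omega>. - X \<omega>) -` C \<inter> space M)"
    using distributed_emeasure[OF X] distributed_emeasure[OF Y] by simp
  moreover have "X -` C \<inter> space M = {\<omega> \<in> space M. X \<omega> \<in> C}"
    "(\<lambda>\<omega>. - X \<omega>) -` C \<inter> space M = {\<omega> \<in> space M. - X \<omega> \<in> C}" by auto
  ultimately show ?thesis by (simp add: measure_def)
qed

lemma
  assumes X: "distributed M lborel X (normal_density 0 \<sigma>)" and s: "\<sigma> > 0"
  shows normal_prob_pos_le: "prob {\<omega> \<in> space M. 0 < X \<omega>} \<le> 1 / 2"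
    and normal_prob_nonneg_ge: "prob {\<omega> \<in> space M. 0 \<le> X \<omega>} \<ge> 1 / 2"
proof -
  have [measurable]: "X \<in> borel_measurable M" using distributed_measurable[OF X] by simp
  have c: "prob {\<omega> \<in> space M. 0 \<le> X \<omega>} = 1 - prob {\<omega> \<in> space M. X \<omega> < 0}"
    by (subst prob_compl[symmetric], measurable) (auto intro!: arg_cong[where f=prob])
  have d: "prob {\<omega> \<in> space M. X \<omega> < 0} = prob {\<omega> \<in> space M. 0 < X \<omega>}"
    using normal_symmetric[OF X s, of "{0<..}"] by simp
  have e: "prob {\<omega> \<in> space M. 0 < X \<omega>} \<le> prob {\<omega> \<in> space M. 0 \<le> X \<omega>}"
    by (intro finite_measure_mono) auto
  show "prob {\<omega> \<in> space M. 0 < X \<omega>} \<le> 1 / 2" "prob {\<omega> \<in> space M. 0 \<le> X \<omega>} \<ge> 1 / 2"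
    using c d e by auto
qed

lemma normal_prob_abs_eq:
  assumes X: "distributed M lborel X (normal_density 0 \<sigma>)" and s: "\<sigma> > 0" "r \<ge> 0"
  shows "prob {\<omega> \<in> space M. \<bar>X \<omega>\<bar> \<le> r} = 1 - 2 * prob {\<omega> \<in> space M. r < X \<omega>}"
proof -
  have [measurable]: "X \<in> borel_measurable M" using distributed_measurable[OF X] by simp
  have "prob {\<omega> \<in> space M. \<bar>X \<omega>\<bar> \<le> r} = 1 - prob ({\<omega> \<in> space M. r < X \<omega>} \<union> {\<omega> \<in> space M. r < - X \<omega>})"
    by (subst prob_compl[symmetric], measurable) (auto intro!: arg_cong[where f=prob])
  also have "prob ({\<omega> \<in> space M. r < X \<omega>} \<union> {\<omega> \<in> space M. r < - X \<omega>}) =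
      prob {\<omega> \<in> space M. r < X \<omega>} + prob {\<omega> \<in> space M. r < - X \<omega>}"
    by (rule finite_measure_Union) (use s in auto)
  also have "prob {\<omega> \<in> space M. r < - X \<omega>} = prob {\<omega> \<in> space M. r < X \<omega>}"
    using normal_symmetric[OF X s(1), of "{r<..}"] by simp
  finally show ?thesis by simp
qed

text \<open>The fourth moment \<open>3 * \<sigma> ^ 4\<close> dominates both quantities, since
  \<open>1 \<le> X ^ 4\<close> and \<open>X \<le> X ^ 4\<close> where X exceeds one. The exponent
  matters: a step of length h contributes \<open>3 * h\<^sup>2\<close>, so the total error of n
  steps covering a fixed time tends to 0 with the mesh.\<close>

lemma
  assumes X: "distributed M lborel X (normal_density 0 \<sigma>)" and s: "\<sigma> > 0"
  shows normal_integrable: "integrable M X"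
    and normal_prob_gt_one: "prob {\<omega> \<in> space M. 1 < X \<omega>} \<le> 3 * \<sigma> ^ 4"
    and normal_integrable_gt_one: "integrable M (\<lambda>\<omega>. X \<omega> * indicator {1<..} (X \<omega>))"
    and normal_expectation_gt_one: "expectation (\<lambda>\<omega>. X \<omega> * indicator {1<..} (X \<omega>)) \<le> 3 * \<sigma> ^ 4"
proof -
  have [measurable]: "X \<in> borel_measurable M" using distributed_measurable[OF X] by simp
  show int: "integrable M X"
    by (rule distributed_integrable_var[OF X]) (use integrable_normal_moment_nz_1[OF s, of 0] in auto)
  have i4: "integrable M (\<lambda>\<omega>. X \<omega> ^ 4)"
    using distributed_integrable[OF X, of "\<lambda>x. x ^ 4"] integrable_normal_moment[OF s, of 0 4] by simp
  have "expectation (\<lambda>\<omega>. X \<omega> ^ 4) = (\<integral>x. normal_density 0 \<sigma> x * x ^ 4 \<partial>lborel)"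
    by (rule distributed_integral[OF X, symmetric]) auto
  also have "\<dots> = fact 4 / ((2 / \<sigma>\<^sup>2)^2 * fact 2)"
    using integral_normal_moment_even[OF s, of 0 2] by simp
  also have "\<dots> = 3 * \<sigma> ^ 4" by (simp add: fact_numeral power_divide)
  finally have e4: "expectation (\<lambda>\<omega>. X \<omega> ^ 4) = 3 * \<sigma> ^ 4" .
  have "prob {\<omega> \<in> space M. 1 < X \<omega>} = expectation (\<lambda>\<omega>. indicator {\<omega> \<in> space M. 1 < X \<omega>} \<omega>)"
    by (subst Bochner_Integration.integral_indicator) auto
  also have "\<dots> \<le> expectation (\<lambda>\<omega>. X \<omega> ^ 4)"
    by (rule integral_mono[OF integrable_real_indicator i4])
      (auto simp: emeasure_eq_measure indicator_def one_le_power)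
  finally show "prob {\<omega> \<in> space M. 1 < X \<omega>} \<le> 3 * \<sigma> ^ 4" using e4 by simp
  show i5: "integrable M (\<lambda>\<omega>. X \<omega> * indicator {1<..} (X \<omega>))"
    by (rule Bochner_Integration.integrable_bound[OF int]) (auto simp: indicator_def)
  have "expectation (\<lambda>\<omega>. X \<omega> * indicator {1<..} (X \<omega>)) \<le> expectation (\<lambda>\<omega>. X \<omega> ^ 4)"
  proof (rule integral_mono[OF i5 i4])
    fix \<omega>
    have "X \<omega> \<le> X \<omega> ^ 4" if "X \<omega> > 1" using power_increasing[of 1 4 "X \<omega>"] that by simp
    thus "X \<omega> * indicator {1<..} (X \<omega>) \<le> X \<omega> ^ 4" by (auto simp: indicator_def)
  qed
  thus "expectation (\<lambda>\<omega>. X \<omega> * indicator {1<..} (X \<omega>)) \<le> 3 * \<sigma> ^ 4" using e4 by simp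
qed

end

lemma gauss_kernel_real:
  "s > 0 \<Longrightarrow> gauss_kernel s (y :: real) = normal_density 0 (sqrt s) y"
proof -
  assume s: "s > 0"
  have "(2 * pi * s) powr (- (1 / 2)) = 1 / (2 * pi * s) powr (1 / 2)" by (rule powr_minus_divide)
  also have "\<dots> = 1 / sqrt (2 * pi * s)" using s by (subst powr_half_sqrt) auto
  finally have "(2 * pi * s) powr (- real DIM(real) / 2) = 1 / sqrt (2 * pi * s)" by simp
  thus ?thesis unfolding gauss_kernel_def normal_density_def using s by simp
qed

section \<open>Small balls, reflection and gambler's ruin on a grid\<close>

locale real_brownian = brownian M B for M :: "'w measure" and B :: "real \<Rightarrow> 'w \<Rightarrow> real"
begin

lemma incr_normal:
  assumes "0 \<le> s" "s < t"
  shows "distributed M lborel (\<lambda>\<omega>. B t \<omega> - B s \<omega>) (normal_density 0 (sqrt (t - s)))"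
proof -
  have "(\<lambda>y. ennreal (gauss_kernel (t - s) (y :: real))) = (\<lambda>y. ennreal (normal_density 0 (sqrt (t - s)) y))"
    using assms by (simp add: gauss_kernel_real)
  with B_incr[OF assms] show ?thesis by simp
qed

lemma B_normal:
  assumes "t > 0"
  shows "distributed M lborel (B t) (normal_density 0 (sqrt t))"
proof -
  have "distr M lborel (\<lambda>\<omega>. B t \<omega> - B 0 \<omega>) = distr M lborel (B t)"
    by (rule distr_cong) (auto simp: B_zero)
  moreover have "B t \<in> borel_measurable M" using assms by simp
  ultimately show ?thesis
    using incr_normal[of 0 t] assms unfolding distributed_def by simp
qed

text \<open>Two successive values of size at most r force an increment of size at most
  \<open>2 * r\<close>, which has probability at most \<open>2 * r / sqrt d\<close> and is
  independent of the past; N blocks yield the power. The factor \<open>prob A\<close> allows a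
  further constraint on the time before s.\<close>

lemma block_bound:
  assumes A: "past_event s A" and s: "0 \<le> s" and d: "d > 0" and r: "r \<ge> 0"
  shows "prob (A \<inter> {\<omega> \<in> space M. \<forall>j\<in>{..N}. \<bar>B (s + real j * d) \<omega>\<bar> \<le> r}) \<le> prob A * (2 * r / sqrt d) ^ N"
proof (induction N)
  case 0
  have "A \<in> sets M" by (rule past_event_sets[OF A])
  thus ?case by (auto intro!: finite_measure_mono)
next
  case (Suc N)
  define E where "E = A \<inter> {\<omega> \<in> space M. \<forall>j\<in>{..N}. \<bar>B (s + real j * d) \<omega>\<bar> \<le> r}"
  define u where "u = s + real N * d"
  have u: "0 \<le> u" "u < u + d" "s \<le> u" using s d by (auto simp: u_def)
  have E: "past_event u E"
    unfolding E_def
  proof (intro past_event_Int past_event_Ball)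
    show "past_event u A" using past_event_mono[OF A u(3)] .
    fix j assume j: "j \<in> {..N}"
    have "s + real j * d \<le> u" unfolding u_def using d j by (auto intro: mult_right_mono)
    hence "past_event u {\<omega> \<in> space M. B (s + real j * d) \<omega> \<in> {-r..r}}"
      using s d by (intro past_event_single) auto
    also have "{\<omega> \<in> space M. B (s + real j * d) \<omega> \<in> {-r..r}} = {\<omega> \<in> space M. \<bar>B (s + real j * d) \<omega>\<bar> \<le> r}"
      by auto
    finally show "past_event u \<dots>" .
  qed (use u in auto)
  define F where "F = {\<omega> \<in> space M. B (u + d) \<omega> - B u \<omega> \<in> {- (2 * r)..2 * r}}"
  have Fabs: "F = {\<omega> \<in> space M. \<bar>B (u + d) \<omega> - B u \<omega>\<bar> \<le> 2 * r}" by (auto simp: F_def)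
  have [measurable]: "E \<in> sets M" by (rule past_event_sets[OF E])
  have [measurable]: "B u \<in> borel_measurable M" "B (u + d) \<in> borel_measurable M" using u by auto
  have "A \<inter> {\<omega> \<in> space M. \<forall>j\<in>{..Suc N}. \<bar>B (s + real j * d) \<omega>\<bar> \<le> r} \<subseteq> E \<inter> F"
  proof
    fix \<omega> assume w: "\<omega> \<in> A \<inter> {\<omega> \<in> space M. \<forall>j\<in>{..Suc N}. \<bar>B (s + real j * d) \<omega>\<bar> \<le> r}"
    hence al: "\<bar>B (s + real j * d) \<omega>\<bar> \<le> r" if "j \<le> Suc N" for j using that by auto
    have "\<bar>B u \<omega>\<bar> \<le> r" "\<bar>B (u + d) \<omega>\<bar> \<le> r"
      using al[of N] al[of "Suc N"] by (simp_all add: u_def algebra_simps)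
    thus "\<omega> \<in> E \<inter> F" using w by (auto simp: E_def F_def)
  qed
  hence "prob (A \<inter> {\<omega> \<in> space M. \<forall>j\<in>{..Suc N}. \<bar>B (s + real j * d) \<omega>\<bar> \<le> r}) \<le> prob (E \<inter> F)"
    unfolding F_def by (intro finite_measure_mono) auto
  also have "\<dots> = prob E * prob F"
    unfolding F_def by (rule past_event_indep[OF E u(1,2)]) simp
  also have "\<dots> \<le> (prob A * (2 * r / sqrt d) ^ N) * (2 * r / sqrt d)"
  proof (rule mult_mono)
    show "prob E \<le> prob A * (2 * r / sqrt d) ^ N" using Suc by (simp add: E_def)
    show "prob F \<le> 2 * r / sqrt d"
      unfolding Fabs using normal_prob_abs_le[OF incr_normal[OF u(1,2)], of "2 * r"] d r by simp
  qed (use r d in auto)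
  finally show ?case by (simp only: power_Suc mult_ac)
qed

lemma past_event_grid:
  assumes "h > 0" "K \<in> sets borel" "real k * h \<le> s"
  shows "past_event s {\<omega> \<in> space M. \<forall>i\<in>{..k}. B (real i * h) \<omega> \<in> K}"
    and "past_event s {\<omega> \<in> space M. \<forall>i\<in>{..<k}. B (real i * h) \<omega> \<in> K}"
proof -
  have "real i * h \<le> s" if "i \<le> k" for i
    using that assms by (meson less_imp_le mult_right_mono of_nat_mono order_trans)
  moreover have "0 \<le> s" using assms by (meson less_imp_le mult_nonneg_nonneg of_nat_0_le_iff order_trans)
  ultimately show "past_event s {\<omega> \<in> space M. \<forall>i\<in>{..k}. B (real i * h) \<omega> \<in> K}"
      "past_event s {\<omega> \<in> space M. \<forall>i\<in>{..<k}. B (real i * h) \<omega> \<in> K}"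
    using assms by (auto intro!: past_event_Ball past_event_single)
qed

text \<open>Partitioning by the exit index replaces a stopping time: each member is determined by
  the past of \<open>k * h\<close>, so \<open>past_event_indep\<close> applies to the increment
  after it.\<close>

definition first_exit :: "real \<Rightarrow> real set \<Rightarrow> nat \<Rightarrow> 'w set" where
  "first_exit h K k = {\<omega> \<in> space M. \<forall>i\<in>{..<k}. B (real i * h) \<omega> \<in> K} \<inter> {\<omega> \<in> space M. B (real k * h) \<omega> \<in> - K}"

lemma past_event_first_exit:
  assumes "h > 0" "K \<in> sets borel"
  shows "past_event (real k * h) (first_exit h K k)"
  unfolding first_exit_def using assms
  by (intro past_event_Int past_event_grid(2) past_event_single) auto

lemma first_exit_sets [measurable]: "h > 0 \<Longrightarrow> K \<in> sets borel \<Longrightarrow> first_exit h K k \<in> sets M"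
  by (rule past_event_sets[OF past_event_first_exit])

lemma first_exit_disjoint: "disjoint_family (first_exit h K)"
proof -
  have "first_exit h K i \<inter> first_exit h K j = {}" if "i < j" for i j
    using that by (auto simp: first_exit_def)
  thus ?thesis by (simp add: disjoint_family_on_def) (metis Int_commute nat_neq_iff)
qed

lemma first_exit_Union:
  "space M - {\<omega> \<in> space M. \<forall>i\<in>{..n}. B (real i * h) \<omega> \<in> K} = (\<Union>k\<in>{..n}. first_exit h K k)"
proof (intro equalityI subsetI)
  fix \<omega> assume w: "\<omega> \<in> space M - {\<omega> \<in> space M. \<forall>i\<in>{..n}. B (real i * h) \<omega> \<in> K}"
  then obtain i where i: "i \<le> n" "B (real i * h) \<omega> \<notin> K" by auto
  define k where "k = (LEAST i. B (real i * h) \<omega> \<notin> K)"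
  have k: "B (real k * h) \<omega> \<notin> K" "k \<le> i" "\<And>j. j < k \<Longrightarrow> B (real j * h) \<omega> \<in> K"
    unfolding k_def using LeastI[of "\<lambda>i. B (real i * h) \<omega> \<notin> K", OF i(2)]
    by (auto intro!: Least_le i(2) dest: not_less_Least)
  thus "\<omega> \<in> (\<Union>k\<in>{..n}. first_exit h K k)" using w i by (auto simp: first_exit_def intro!: bexI[of _ k])
qed (auto simp: first_exit_def)

lemma prob_first_exit:
  assumes "h > 0" "K \<in> sets borel"
  shows "prob {\<omega> \<in> space M. \<forall>i\<in>{..n}. B (real i * h) \<omega> \<in> K} = 1 - (\<Sum>k\<le>n. prob (first_exit h K k))"
proof -
  let ?S = "{\<omega> \<in> space M. \<forall>i\<in>{..n}. B (real i * h) \<omega> \<in> K}"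
  have S: "?S \<in> sets M" by (rule past_event_sets[OF past_event_grid(1)[OF assms order_refl]])
  have "1 - prob ?S = prob (\<Union>k\<in>{..n}. first_exit h K k)"
    unfolding first_exit_Union[symmetric] using prob_compl[OF S] by simp
  also have "\<dots> = (\<Sum>k\<in>{..n}. prob (first_exit h K k))"
    using assms first_exit_disjoint[of h K]
    by (intro finite_measure_finite_Union) (auto simp: disjoint_family_on_def)
  finally show ?thesis by simp
qed

text \<open>Reflection at the first exit time \<open>k * h\<close>: the remaining increment is nonnegative with
  probability at least \<open>1 / 2\<close>.\<close>

lemma max_grid_lower:
  assumes h: "h > 0" and n: "n > 0" and a: "a \<ge> 0"
  shows "prob {\<omega> \<in> space M. \<forall>i\<in>{..n}. B (real i * h) \<omega> \<in> {..a}} \<ge> prob {\<omega> \<in> space M. \<bar>B (real n * h) \<omega>\<bar> \<le> a}"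
proof -
  define t where "t = real n * h"
  have t: "t > 0" using h n by (simp add: t_def)
  have [measurable]: "B t \<in> borel_measurable M" using t by simp
  have [measurable]: "B (real k * h) \<in> borel_measurable M" for k using h by simp
  let ?E = "first_exit h {..a}"
  \<comment> \<open>For \<open>k < n\<close> the exit value exceeds \<open>a\<close> and a
    nonnegative remaining increment keeps the path above; for \<open>k = n\<close> nothing remains
    and the exit itself means \<open>a < B t\<close>.\<close>
  have E: "prob (?E k) / 2 \<le> prob (?E k \<inter> {\<omega> \<in> space M. a < B t \<omega>})" if k: "k \<le> n" for k
  proof (cases "k = n")
    case True
    have "?E k \<inter> {\<omega> \<in> space M. a < B t \<omega>} = ?E k" by (auto simp: True first_exit_def t_def)
    thus ?thesis by (simp add: measure_nonneg)
  next
    case False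
    hence kt: "real k * h < t" using k h by (simp add: t_def)
    have k0: "0 \<le> real k * h" using h by simp
    have "prob (?E k) * (1 / 2) \<le> prob (?E k) * prob {\<omega> \<in> space M. B t \<omega> - B (real k * h) \<omega> \<in> {0..}}"
      using normal_prob_nonneg_ge[OF incr_normal[OF k0 kt]] kt by (intro mult_left_mono) auto
    also have "\<dots> = prob (?E k \<inter> {\<omega> \<in> space M. B t \<omega> - B (real k * h) \<omega> \<in> {0..}})"
      by (rule past_event_indep[OF past_event_first_exit[OF h] k0 kt, symmetric]) auto
    also have "\<dots> \<le> prob (?E k \<inter> {\<omega> \<in> space M. a < B t \<omega>})"
      by (intro finite_measure_mono) (use h in \<open>auto simp: first_exit_def\<close>)
    finally show ?thesis by simp
  qed
  have "(\<Sum>k\<le>n. prob (?E k)) / 2 \<le> (\<Sum>k\<le>n. prob (?E k \<inter> {\<omega> \<in> space M. a < B t \<omega>}))"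
    unfolding sum_divide_distrib by (intro sum_mono E) auto
  also have "\<dots> = prob (\<Union>k\<in>{..n}. ?E k \<inter> {\<omega> \<in> space M. a < B t \<omega>})"
    using h first_exit_disjoint[of h "{..a}"]
    by (intro finite_measure_finite_Union[symmetric]) (auto simp: disjoint_family_on_def)
  also have "\<dots> \<le> prob {\<omega> \<in> space M. a < B t \<omega>}"
    by (intro finite_measure_mono) auto
  finally have "(\<Sum>k\<le>n. prob (?E k)) \<le> 2 * prob {\<omega> \<in> space M. a < B t \<omega>}" by simp
  moreover have "prob {\<omega> \<in> space M. \<bar>B t \<omega>\<bar> \<le> a} = 1 - 2 * prob {\<omega> \<in> space M. a < B t \<omega>}"
    using t a by (intro normal_prob_abs_eq[OF B_normal]) auto
  ultimately show ?thesis using prob_first_exit[OF h, of "{..a}" n] by (simp add: t_def)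
qed

text \<open>The converse estimate: the walk overshoots \<open>a\<close> by at most one, unless one of the \<open>n\<close> steps exceeds
  one.\<close>

lemma max_grid_upper:
  assumes h: "h > 0" and n: "n > 0" and a: "a \<ge> 0"
  shows "prob {\<omega> \<in> space M. \<forall>i\<in>{..n}. B (real i * h) \<omega> \<in> {..a}} \<le> prob {\<omega> \<in> space M. \<bar>B (real n * h) \<omega>\<bar> \<le> a + 1} + 6 * real n * h\<^sup>2"
proof -
  define t where "t = real n * h"
  have t: "t > 0" using h n by (simp add: t_def)
  have [measurable]: "B t \<in> borel_measurable M" using t by simp
  have [measurable]: "B (real k * h) \<in> borel_measurable M" for k using h by simp
  let ?E = "first_exit h {..a}"
  let ?G = "{\<omega> \<in> space M. a + 1 < B t \<omega>}"
  define J where "J k = {\<omega> \<in> space M. 1 < B (real (Suc k) * h) \<omega> - B (real k * h) \<omega>}" for k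
  have [measurable]: "J k \<in> sets M" for k unfolding J_def by measurable
  have J: "prob (J k) \<le> 3 * h\<^sup>2" for k
  proof -
    have 1: "0 \<le> real k * h" "real k * h < real (Suc k) * h" using h by auto
    have "real (Suc k) * h - real k * h = h" by (simp add: algebra_simps)
    moreover have "sqrt h ^ 4 = h\<^sup>2" using h by (simp add: power4_eq_xxxx power2_eq_square)
    ultimately show ?thesis using normal_prob_gt_one[OF incr_normal[OF 1]] h by (simp add: J_def)
  qed
  \<comment> \<open>Since \<open>B 0 = 0\<close> lies in \<open>{..a}\<close>, every exit index has
    a predecessor, at which the value is at most \<open>a\<close>.\<close>
  have E0: "?E 0 = {}" using a by (auto simp: first_exit_def B_zero)
  \<comment> \<open>Either step \<open>k\<close> exceeds one, or the exit value is at most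
    \<open>a + 1\<close> and \<open>B t > a + 1\<close> forces a positive later increment. For
    \<open>Suc k = n\<close> only the first alternative is possible.\<close>
  have E: "prob (?E (Suc k) \<inter> ?G) \<le> 3 * h\<^sup>2 + prob (?E (Suc k)) / 2" if k: "Suc k \<le> n" for k
  proof (cases "Suc k = n")
    case True
    have "?E (Suc k) \<inter> ?G \<subseteq> J k"
    proof
      fix \<omega> assume w: "\<omega> \<in> ?E (Suc k) \<inter> ?G"
      hence "B (real k * h) \<omega> \<le> a" by (auto simp: first_exit_def)
      thus "\<omega> \<in> J k" using w unfolding J_def t_def True[symmetric] by auto
    qed
    hence "prob (?E (Suc k) \<inter> ?G) \<le> prob (J k)" by (intro finite_measure_mono) auto
    thus ?thesis using J[of k] measure_nonneg[of M "?E (Suc k)"] by linarith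
  next
    case False
    hence "Suc k < n" using k by simp
    hence "real (Suc k) < real n" by (simp only: of_nat_less_iff)
    hence kt: "real (Suc k) * h < t" using h unfolding t_def by (rule mult_strict_right_mono)
    have k0: "0 \<le> real (Suc k) * h" using h by simp
    let ?I = "{\<omega> \<in> space M. B t \<omega> - B (real (Suc k) * h) \<omega> \<in> {0<..}}"
    have "?E (Suc k) \<inter> ?G \<subseteq> J k \<union> (?E (Suc k) \<inter> ?I)"
    proof
      fix \<omega> assume w: "\<omega> \<in> ?E (Suc k) \<inter> ?G"
      hence "B (real k * h) \<omega> \<le> a" "\<omega> \<in> space M" "B t \<omega> > a + 1" by (auto simp: first_exit_def)
      thus "\<omega> \<in> J k \<union> (?E (Suc k) \<inter> ?I)" using w unfolding J_def by auto
    qed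
    hence "prob (?E (Suc k) \<inter> ?G) \<le> prob (J k \<union> (?E (Suc k) \<inter> ?I))"
      by (intro finite_measure_mono) (use h in auto)
    also have "\<dots> \<le> prob (J k) + prob (?E (Suc k) \<inter> ?I)"
      by (intro measure_Un_le) (use h in auto)
    also have "prob (?E (Suc k) \<inter> ?I) = prob (?E (Suc k)) * prob ?I"
      by (rule past_event_indep[OF past_event_first_exit[OF h] k0 kt]) auto
    also have "\<dots> \<le> prob (?E (Suc k)) * (1 / 2)"
      using normal_prob_pos_le[OF incr_normal[OF k0 kt]] kt by (intro mult_left_mono) auto
    finally show ?thesis using J[of k] by simp
  qed
  have "{\<omega> \<in> space M. a + 1 < B t \<omega>} \<subseteq> space M - {\<omega> \<in> space M. \<forall>i\<in>{..n}. B (real i * h) \<omega> \<in> {..a}}"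
  proof
    fix \<omega> assume w: "\<omega> \<in> ?G"
    hence "\<not> B (real n * h) \<omega> \<le> a" by (simp add: t_def)
    thus "\<omega> \<in> space M - {\<omega> \<in> space M. \<forall>i\<in>{..n}. B (real i * h) \<omega> \<in> {..a}}" using w by auto
  qed
  hence "?G = (\<Union>k\<in>{..n}. ?E k \<inter> ?G)" unfolding first_exit_Union by blast
  hence "prob ?G = prob (\<Union>k\<in>{..n}. ?E k \<inter> ?G)" by simp
  also have "\<dots> = (\<Sum>k\<le>n. prob (?E k \<inter> ?G))"
    using h first_exit_disjoint[of h "{..a}"]
    by (intro finite_measure_finite_Union) (auto simp: disjoint_family_on_def)
  also have "\<dots> = (\<Sum>k<n. prob (?E (Suc k) \<inter> ?G))"
    by (simp add: sum.atMost_shift E0)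
  also have "\<dots> \<le> (\<Sum>k<n. 3 * h\<^sup>2 + prob (?E (Suc k)) / 2)"
    by (intro sum_mono E) auto
  also have "\<dots> = 3 * real n * h\<^sup>2 + (\<Sum>k\<le>n. prob (?E k)) / 2"
    by (simp add: sum.distrib sum_divide_distrib sum.atMost_shift E0)
  finally have "2 * prob ?G \<le> 6 * real n * h\<^sup>2 + (\<Sum>k\<le>n. prob (?E k))" by simp
  moreover have "prob {\<omega> \<in> space M. \<bar>B t \<omega>\<bar> \<le> a + 1} = 1 - 2 * prob ?G"
    using t a by (intro normal_prob_abs_eq[OF B_normal]) auto
  ultimately show ?thesis using prob_first_exit[OF h, of "{..a}" n] by (simp add: t_def)
qed

text \<open>Gambler's ruin: stopping \<open>B\<close> at the first exit from \<open>[-L, a]\<close> keeps its mean zero, so the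
  exit through \<open>- L\<close> has probability of order at most \<open>a / L\<close>.\<close>

lemma strip_grid_lower:
  assumes h: "h > 0" and n: "n > 0" and a: "a \<ge> 0" and L: "L > 0"
  shows "prob {\<omega> \<in> space M. \<forall>i\<in>{..n}. B (real i * h) \<omega> \<in> {-L..a}}
    \<ge> prob {\<omega> \<in> space M. \<bar>B (real n * h) \<omega>\<bar> \<le> a} - (a + 1 + 3 * real n * h\<^sup>2) / L"
proof -
  define t where "t = real n * h"
  have t: "t > 0" using h n by (simp add: t_def)
  have [measurable]: "B t \<in> borel_measurable M" using t by simp
  have [measurable]: "B (real k * h) \<in> borel_measurable M" for k using h by simp
  let ?E = "first_exit h {-L..a}"
  let ?H = "{\<omega> \<in> space M. \<forall>i\<in>{..n}. B (real i * h) \<omega> \<in> {-L..a}}"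
  let ?S = "{\<omega> \<in> space M. \<forall>i\<in>{..n}. B (real i * h) \<omega> \<in> {..a}}"
  define X where "X k \<omega> = B (real (Suc k) * h) \<omega> - B (real k * h) \<omega>" for k \<omega>
  \<comment> \<open>Only a step larger than one can overshoot \<open>a\<close> by more than one.
    \<open>Z\<close> keeps such steps whole, so that \<open>X \<le> 1 + Z\<close>, while its mean is
    at most \<open>3 * h\<^sup>2\<close>.\<close>
  define Z where "Z k \<omega> = X k \<omega> * indicator {1<..} (X k \<omega>)" for k \<omega>
  have Z: "integrable M (Z k)" "expectation (Z k) \<le> 3 * h\<^sup>2" for k
  proof -
    have 1: "0 \<le> real k * h" "real k * h < real (Suc k) * h" using h by auto
    have 2: "real (Suc k) * h - real k * h = h" by (simp add: algebra_simps)
    have "sqrt h ^ 4 = h\<^sup>2" using h by (simp add: power4_eq_xxxx power2_eq_square)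
    thus "integrable M (Z k)" "expectation (Z k) \<le> 3 * h\<^sup>2"
      using normal_integrable_gt_one[OF incr_normal[OF 1]] normal_expectation_gt_one[OF incr_normal[OF 1]] h
      unfolding Z_def X_def 2 by auto
  qed
  have Z0: "Z k \<omega> \<ge> 0" "X k \<omega> \<le> 1 + Z k \<omega>" for k \<omega> by (auto simp: Z_def indicator_def)
  \<comment> \<open>\<open>V k\<close> is the movement from an exit at index k up to time t.
    Subtracting all of them from \<open>B t\<close> leaves the value at the exit, or
    \<open>B t\<close> itself if there is none; each has mean zero by independence.\<close>
  define V where "V k \<omega> = indicator (?E k) \<omega> * (B t \<omega> - B (real k * h) \<omega>)" for k \<omega>
  have V: "integrable M (V k) \<and> expectation (V k) = 0" if k: "k \<le> n" for k
  proof (cases "k = n")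
    case True
    hence "V k = (\<lambda>_. 0)" by (simp add: V_def t_def fun_eq_iff)
    thus ?thesis by simp
  next
    case False
    hence kt: "real k * h < t" using k h by (simp add: t_def)
    have k0: "0 \<le> real k * h" using h by simp
    have D: "distributed M lborel (\<lambda>\<omega>. B t \<omega> - B (real k * h) \<omega>) (normal_density 0 (sqrt (t - real k * h)))"
      by (rule incr_normal[OF k0 kt])
    have i: "integrable M (\<lambda>\<omega>. B t \<omega> - B (real k * h) \<omega>)" "expectation (\<lambda>\<omega>. B t \<omega> - B (real k * h) \<omega>) = 0"
      using normal_integrable[OF D] normal_distributed_expectation[OF _ D] kt by auto
    have ind: "indep_var borel (indicator (?E k) :: 'w \<Rightarrow> real) borel (\<lambda>\<omega>. B t \<omega> - B (real k * h) \<omega>)"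
      by (rule past_event_indep_var[OF past_event_first_exit[OF h] k0 kt]) auto
    have iE: "integrable M (indicator (?E k) :: 'w \<Rightarrow> real)"
      using h by (intro integrable_real_indicator) (auto simp: emeasure_eq_measure)
    show ?thesis
      using indep_var_integrable[OF ind iE i(1)] indep_var_lebesgue_integral[OF ind iE i(1)] i(2)
      unfolding V_def by simp
  qed
  have D: "distributed M lborel (B t) (normal_density 0 (sqrt t))" using B_normal[OF t] .
  have iB: "integrable M (B t)" "expectation (B t) = 0"
    using normal_integrable[OF D] normal_distributed_expectation[OF _ D] t by auto
  have H: "?H \<in> sets M" by (rule past_event_sets[OF past_event_grid(1)[OF h _ order_refl]]) simp
  have S: "?S \<in> sets M" by (rule past_event_sets[OF past_event_grid(1)[OF h _ order_refl]]) simp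
  have sub: "?H \<subseteq> ?S" by auto
  \<comment> \<open>The stopped value is at most \<open>a\<close> plus an overshoot. On
    \<open>?S - ?H\<close> the grid path leaves the strip without exceeding \<open>a\<close>, hence
    below \<open>- L\<close>; this accounts for the last term.\<close>
  have pt: "B t \<omega> - (\<Sum>k\<le>n. V k \<omega>) \<le> (a + 1) + (\<Sum>k<n. Z k \<omega>) - L * indicator (?S - ?H) \<omega>"
    if w: "\<omega> \<in> space M" for \<omega>
  proof (cases "\<omega> \<in> ?H")
    case True
    have "\<omega> \<notin> ?E k" if "k \<le> n" for k using True that by (auto simp: first_exit_def)
    hence "(\<Sum>k\<le>n. V k \<omega>) = 0" by (intro sum.neutral) (auto simp: V_def)
    moreover have "B t \<omega> \<le> a" using True by (auto simp: t_def)
    moreover have "(\<Sum>k<n. Z k \<omega>) \<ge> 0" by (intro sum_nonneg Z0)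
    ultimately show ?thesis using True by simp
  next
    case False
    then obtain k where k: "k \<le> n" "\<omega> \<in> ?E k" using first_exit_Union[of n h "{-L..a}"] w by blast
    have "V j \<omega> = (if j = k then B t \<omega> - B (real k * h) \<omega> else 0)" if "j \<le> n" for j
    proof (cases "j = k")
      case False
      hence "\<omega> \<notin> ?E j" using k(2) first_exit_disjoint[of h "{-L..a}"] by (auto simp: disjoint_family_on_def)
      thus ?thesis using False by (simp add: V_def)
    qed (use k in \<open>simp add: V_def\<close>)
    hence "(\<Sum>j\<le>n. V j \<omega>) = (\<Sum>j\<le>n. if j = k then B t \<omega> - B (real k * h) \<omega> else 0)"
      by (intro sum.cong) auto
    also have "\<dots> = B t \<omega> - B (real k * h) \<omega>" using k by simp
    finally have e: "B t \<omega> - (\<Sum>k\<le>n. V k \<omega>) = B (real k * h) \<omega>" by simp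
    have k0: "k \<noteq> 0"
      using k(2) a L w by (auto simp: first_exit_def B_zero intro!: Nat.gr0I)
    then obtain l where l: "k = Suc l" using not0_implies_Suc by blast
    have Zs: "(\<Sum>k<n. Z k \<omega>) \<ge> Z l \<omega>" using k(1) l by (intro member_le_sum Z0) auto
    have "B (real l * h) \<omega> \<le> a" using k(2) l by (auto simp: first_exit_def)
    hence b: "B (real k * h) \<omega> \<le> a + 1 + (\<Sum>k<n. Z k \<omega>)"
      using Z0(2)[of l \<omega>] Zs unfolding l X_def by linarith
    show ?thesis
    proof (cases "\<omega> \<in> ?S")
      case True
      hence "B (real k * h) \<omega> \<le> a" using k(1) by auto
      hence "B (real k * h) \<omega> < - L" using k(2) by (auto simp: first_exit_def)
      moreover have "(\<Sum>k<n. Z k \<omega>) \<ge> 0" by (intro sum_nonneg Z0)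
      ultimately show ?thesis unfolding e using True False a by simp
    next
      case 2: False
      thus ?thesis unfolding e using b by simp
    qed
  qed
  have "expectation (\<lambda>\<omega>. B t \<omega> - (\<Sum>k\<le>n. V k \<omega>)) \<le>
    expectation (\<lambda>\<omega>. (a + 1) + (\<Sum>k<n. Z k \<omega>) - L * indicator (?S - ?H) \<omega>)"
    using iB V Z(1) H S
    by (intro integral_mono pt Bochner_Integration.integrable_diff Bochner_Integration.integrable_add
        Bochner_Integration.integrable_sum integrable_mult_right integrable_real_indicator)
       (auto simp: emeasure_eq_measure)
  also have "expectation (\<lambda>\<omega>. B t \<omega> - (\<Sum>k\<le>n. V k \<omega>)) = 0"
    using iB V by (subst Bochner_Integration.integral_diff) (auto simp: Bochner_Integration.integral_sum)
  also have "expectation (\<lambda>\<omega>. (a + 1) + (\<Sum>k<n. Z k \<omega>) - L * indicator (?S - ?H) \<omega>) =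
     (a + 1) + (\<Sum>k<n. expectation (Z k)) - L * prob (?S - ?H)"
  proof -
    have iI: "integrable M (indicator (?S - ?H) :: 'w \<Rightarrow> real)"
      using H S by (intro integrable_real_indicator) (auto simp: emeasure_eq_measure)
    have "expectation (indicator (?S - ?H)) = prob (?S - ?H)" using H S by simp
    thus ?thesis using Z(1) iI
      by (simp add: Bochner_Integration.integral_diff Bochner_Integration.integral_add
          Bochner_Integration.integral_sum prob_space)
  qed
  finally have "L * prob (?S - ?H) \<le> (a + 1) + (\<Sum>k<n. expectation (Z k))" by simp
  also have "(\<Sum>k<n. expectation (Z k)) \<le> (\<Sum>k<n. 3 * h\<^sup>2)" by (intro sum_mono Z)
  finally have "L * prob (?S - ?H) \<le> a + 1 + 3 * real n * h\<^sup>2" by (simp add: algebra_simps)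
  hence "prob (?S - ?H) \<le> (a + 1 + 3 * real n * h\<^sup>2) / L" using L by (simp add: field_simps)
  moreover have "prob (?S - ?H) = prob ?S - prob ?H" using finite_measure_Diff[OF S H sub] .
  ultimately show ?thesis using max_grid_lower[OF h n a] by simp
qed

end

section \<open>From grids to continuous time\<close>

definition dyadic_grid :: "real \<Rightarrow> nat \<Rightarrow> real set" where
  "dyadic_grid u k = (\<lambda>i. real i * (u / 2 ^ k)) ` {..2 ^ k}"

lemma dyadic_grid_mono: "dyadic_grid u k \<subseteq> dyadic_grid u (Suc k)"
proof
  fix s assume "s \<in> dyadic_grid u k"
  then obtain i where i: "i \<le> 2 ^ k" "s = real i * (u / 2 ^ k)" by (auto simp: dyadic_grid_def)
  hence "s = real (2 * i) * (u / 2 ^ Suc k)" "2 * i \<le> 2 ^ Suc k" by (auto simp: field_simps)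
  thus "s \<in> dyadic_grid u (Suc k)" unfolding dyadic_grid_def by blast
qed

lemma dyadic_grid_subset: "u \<ge> 0 \<Longrightarrow> dyadic_grid u k \<subseteq> {0..u}"
proof
  fix s assume u: "u \<ge> 0" and "s \<in> dyadic_grid u k"
  then obtain i where i: "i \<le> 2 ^ k" "s = real i * (u / 2 ^ k)" by (auto simp: dyadic_grid_def)
  have "real i \<le> 2 ^ k" using i(1) by (metis of_nat_le_iff of_nat_numeral of_nat_power)
  hence "real i * (u / 2 ^ k) \<le> 2 ^ k * (u / 2 ^ k)" using u by (intro mult_right_mono) auto
  thus "s \<in> {0..u}" using i u by simp
qed

text \<open>Each s is the limit of the grid points obtained by rounding \<open>s * 2 ^ k / u\<close>
  down to an integer; continuity and closedness pass membership to the limit. The case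
  \<open>u = 0\<close> is separate because of this division.\<close>

lemma stays_in_closed_iff_grid:
  fixes f :: "real \<Rightarrow> 'a::metric_space"
  assumes f: "continuous_on {0..} f" and K: "closed K" and u: "u \<ge> 0"
  shows "(\<forall>s\<in>{0..u}. f s \<in> K) \<longleftrightarrow> (\<forall>k. \<forall>s\<in>dyadic_grid u k. f s \<in> K)"
proof
  assume "\<forall>s\<in>{0..u}. f s \<in> K"
  thus "\<forall>k. \<forall>s\<in>dyadic_grid u k. f s \<in> K" using dyadic_grid_subset[OF u] by blast
next
  assume g: "\<forall>k. \<forall>s\<in>dyadic_grid u k. f s \<in> K"
  show "\<forall>s\<in>{0..u}. f s \<in> K"
  proof
    fix s assume s: "s \<in> {0..u}"
    show "f s \<in> K"
    proof (cases "u = 0")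
      case True
      have "0 \<in> dyadic_grid u 0" by (auto simp: dyadic_grid_def)
      thus ?thesis using g s True by auto
    next
      case False
      hence up: "u > 0" using u by simp
      define i where "i k = nat \<lfloor>s * 2 ^ k / u\<rfloor>" for k
      define r where "r k = real (i k) * (u / 2 ^ k)" for k
      have ri: "real (i k) = of_int \<lfloor>s * 2 ^ k / u\<rfloor>" for k
        using s up by (simp add: i_def)
      have le: "real (i k) \<le> s * 2 ^ k / u" "s * 2 ^ k / u \<le> real (i k) + 1" for k
        unfolding ri by linarith+
      have "s * 2 ^ k / u \<le> 2 ^ k" for k using s up by (simp add: field_simps)
      hence "real (i k) \<le> 2 ^ k" for k using le(1) order_trans by blast
      hence "i k \<le> 2 ^ k" for k by (metis of_nat_le_iff of_nat_numeral of_nat_power)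
      hence mem: "r k \<in> dyadic_grid u k" for k by (auto simp: r_def dyadic_grid_def)
      have b1: "r k \<le> s" for k using le(1)[of k] up by (simp add: r_def field_simps)
      have b2: "s - u * (1 / 2) ^ k \<le> r k" for k
      proof -
        have "s = (s * 2 ^ k / u) * (u / 2 ^ k)" using up by simp
        also have "\<dots> \<le> (real (i k) + 1) * (u / 2 ^ k)" using le(2)[of k] up by (intro mult_right_mono) auto
        also have "\<dots> = r k + u * (1 / 2) ^ k" by (simp add: r_def distrib_right power_one_over add_divide_distrib)
        finally show ?thesis by simp
      qed
      have "(\<lambda>k. (1 / 2 :: real) ^ k) \<longlonglongrightarrow> 0" by (rule LIMSEQ_realpow_zero) auto
      hence lim: "(\<lambda>k. s - u * (1 / 2) ^ k) \<longlonglongrightarrow> s"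
        using tendsto_diff[OF tendsto_const[of s] tendsto_mult[OF tendsto_const[of u]]] by fastforce
      have "r \<longlonglongrightarrow> s"
      proof (rule tendsto_sandwich[OF _ _ lim tendsto_const])
        show "\<forall>\<^sub>F k in sequentially. s - u * (1 / 2) ^ k \<le> r k" by (rule always_eventually) (use b2 in blast)
        show "\<forall>\<^sub>F k in sequentially. r k \<le> s" by (rule always_eventually) (use b1 in blast)
      qed
      moreover have "r k \<in> {0..}" for k using mem[of k] dyadic_grid_subset[OF u, of k] by auto
      ultimately have "(\<lambda>k. f (r k)) \<longlonglongrightarrow> f s"
        using s by (intro continuous_on_tendsto_compose[OF f]) (auto intro!: always_eventually)
      moreover have "f (r k) \<in> K" for k using g mem by blast
      ultimately show ?thesis using closed_sequentially[OF K, of "\<lambda>k. f (r k)" "f s"] by blast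
    qed
  qed
qed

text \<open>Openness at the endpoint gives extra time. This slack makes the exit time strictly
  exceed u, and later leaves room for rational levels beyond the extrema of
  \<open>Y\<close>.\<close>

lemma stays_in_open_extend:
  fixes f :: "real \<Rightarrow> 'a::topological_space"
  assumes f: "continuous_on {0..} f" and D: "open D" and u: "u \<ge> 0" and st: "\<forall>s\<in>{0..u}. f s \<in> D"
  obtains e where "e > 0" "\<forall>s\<in>{0..u + e}. f s \<in> D"
proof -
  have "(f \<longlongrightarrow> f u) (at u within {0..})" using f u by (auto simp: continuous_on_def)
  hence "eventually (\<lambda>s. f s \<in> D) (at u within {0..})"
    by (rule topological_tendstoD) (use D st u in auto)
  then obtain d where d: "d > 0" "\<And>s. s \<in> {0..} \<Longrightarrow> s \<noteq> u \<Longrightarrow> dist s u < d \<Longrightarrow> f s \<in> D"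
    unfolding eventually_at by blast
  have "\<forall>s\<in>{0..u + d / 2}. f s \<in> D"
  proof
    fix s assume s: "s \<in> {0..u + d / 2}"
    show "f s \<in> D"
    proof (cases "s \<le> u")
      case True thus ?thesis using st s by auto
    next
      case False
      thus ?thesis using s d(1) by (intro d(2)) (auto simp: dist_real_def)
    qed
  qed
  thus ?thesis using d(1) by (intro that[of "d / 2"]) auto
qed

lemma exit_time_gt_iff:
  fixes f :: "real \<Rightarrow> 'a::topological_space"
  assumes f: "continuous_on {0..} f" and D: "open D" and u: "u \<ge> 0"
  shows "exit_time D f > ereal u \<longleftrightarrow> (\<forall>s\<in>{0..u}. f s \<in> D)"
proof
  assume e: "exit_time D f > ereal u"
  show "\<forall>s\<in>{0..u}. f s \<in> D"
  proof (rule ccontr)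
    assume "\<not> (\<forall>s\<in>{0..u}. f s \<in> D)"
    then obtain s where s: "s \<in> {0..u}" "f s \<notin> D" by blast
    hence "exit_time D f \<le> ereal s" unfolding exit_time_def by (intro Inf_lower) auto
    also have "\<dots> \<le> ereal u" using s by simp
    finally show False using e by simp
  qed
next
  assume "\<forall>s\<in>{0..u}. f s \<in> D"
  then obtain e where e: "e > 0" "\<forall>s\<in>{0..u + e}. f s \<in> D"
    using stays_in_open_extend[OF f D u] by blast
  have "ereal (u + e) \<le> exit_time D f"
    unfolding exit_time_def
  proof (rule Inf_greatest)
    fix z assume "z \<in> ereal ` {t. 0 \<le> t \<and> f t \<notin> D}"
    then obtain t where t: "z = ereal t" "0 \<le> t" "f t \<notin> D" by blast
    hence "\<not> t \<le> u + e" using e(2) by auto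
    thus "ereal (u + e) \<le> z" using t by simp
  qed
  moreover have "ereal u < ereal (u + e)" using e by simp
  ultimately show "exit_time D f > ereal u" by (rule less_le_trans[rotated])
qed

lemma sets_Collect_mem:
  "f \<in> N \<rightarrow>\<^sub>M L \<Longrightarrow> K \<in> sets L \<Longrightarrow> {\<omega> \<in> space N. f \<omega> \<in> K} \<in> sets N"
  using measurable_sets[of f N L K] by (simp add: vimage_def Int_def conj_commute)

text \<open>The open condition \<open>x + y \<in> D\<close> is exhausted by the closed conditions \<open>y \<in> inner_set D x m\<close>, which
  can be tested on grids.\<close>

definition inner_set :: "'a::real_normed_vector set \<Rightarrow> 'a \<Rightarrow> nat \<Rightarrow> 'a set" where
  "inner_set D x m = {y. ball (x + y) (1 / Suc m) \<subseteq> D}"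

lemma closed_inner_set: "closed (inner_set D x m)"
proof -
  have "- inner_set D x m = (\<Union>z\<in>- D. ball (z - x) (1 / Suc m))"
    by (auto simp: inner_set_def dist_norm norm_minus_commute algebra_simps subset_iff)
  thus ?thesis unfolding closed_def by (simp add: open_UN)
qed

lemma inner_set_mono: "incseq (inner_set D x)"
proof (rule incseq_SucI, rule subsetI)
  fix m y assume y: "y \<in> inner_set D x m"
  have "ball (x + y) (1 / Suc (Suc m)) \<subseteq> ball (x + y) (1 / Suc m)"
    by (intro subset_ball) (simp add: field_simps)
  thus "y \<in> inner_set D x (Suc m)" using y unfolding inner_set_def by blast
qed

section \<open>Survival events: measurability and law\<close>

context brownian
begin

text \<open>This is the sigma-algebra for which \<open>indep3\<close> supplies independence, so the
  events of each motion must be placed in it and not just in \<open>sets M\<close>.\<close>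

definition path_algebra :: "'w measure" where
  "path_algebra = vimage_algebra (space M) (path_of B) path_space"

lemma space_path_algebra [simp]: "space path_algebra = space M"
  by (simp add: path_algebra_def)

lemma measurable_path_algebra [measurable]:
  assumes "u \<ge> 0"
  shows "B u \<in> borel_measurable path_algebra"
proof -
  have "path_of B \<in> path_algebra \<rightarrow>\<^sub>M path_space"
    unfolding path_algebra_def
    by (rule measurable_vimage_algebra1) (auto simp: path_space_def space_PiM path_of_def)
  moreover have "(\<lambda>f. f u) \<in> path_space \<rightarrow>\<^sub>M (borel :: 'a measure)"
    unfolding path_space_def by (rule measurable_component_singleton) (use assms in simp)
  ultimately have "(\<lambda>\<omega>. path_of B \<omega> u) \<in> borel_measurable path_algebra"
    by (rule measurable_compose)
  thus ?thesis using assms by (simp add: path_of_def)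
qed

definition stays :: "'a set \<Rightarrow> real \<Rightarrow> 'w set" where
  "stays K u = {\<omega> \<in> space M. \<forall>s\<in>{0..u}. B s \<omega> \<in> K}"

definition stays_grid :: "'a set \<Rightarrow> real \<Rightarrow> nat \<Rightarrow> 'w set" where
  "stays_grid K u k = {\<omega> \<in> space M. \<forall>s\<in>dyadic_grid u k. B s \<omega> \<in> K}"

lemma stays_grid_path_algebra:
  assumes "K \<in> sets borel" "u \<ge> 0"
  shows "stays_grid K u k \<in> sets path_algebra"
proof -
  have "\<And>s. s \<in> dyadic_grid u k \<Longrightarrow> s \<ge> 0" using dyadic_grid_subset[OF assms(2)] by fastforce
  hence "{\<omega> \<in> space path_algebra. \<forall>s\<in>dyadic_grid u k. B s \<omega> \<in> K} \<in> sets path_algebra"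
    using assms(1) by (intro sets.sets_Collect_finite_All sets_Collect_mem[OF measurable_path_algebra])
      (auto simp: dyadic_grid_def)
  thus ?thesis by (simp add: stays_grid_def)
qed

lemma path_algebra_subset: "sets path_algebra \<subseteq> sets M"
proof -
  have "path_of B \<in> M \<rightarrow>\<^sub>M path_space"
    unfolding path_space_def path_of_def[abs_def] by (intro measurable_restrict rv) auto
  thus ?thesis unfolding path_algebra_def by (intro sets_image_in_sets) auto
qed

lemma stays_eq_Inter:
  assumes "closed K" "u \<ge> 0"
  shows "stays K u = (\<Inter>k. stays_grid K u k)"
  using stays_in_closed_iff_grid[OF B_cont assms] by (auto simp: stays_def stays_grid_def)

lemma stays_path_algebra:
  assumes "closed K" "u \<ge> 0"
  shows "stays K u \<in> sets path_algebra"
  unfolding stays_eq_Inter[OF assms]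
  by (rule sets.countable_INT) (use stays_grid_path_algebra assms in \<open>auto intro: borel_closed\<close>)

lemma stays_grid_tendsto:
  assumes "closed K" "u \<ge> 0"
  shows "(\<lambda>k. prob (stays_grid K u k)) \<longlonglongrightarrow> prob (stays K u)"
  unfolding stays_eq_Inter[OF assms]
proof (rule finite_Lim_measure_decseq)
  show "range (stays_grid K u) \<subseteq> sets M"
    by (intro image_subsetI subsetD[OF path_algebra_subset] stays_grid_path_algebra borel_closed assms)
  show "decseq (stays_grid K u)"
    by (rule decseq_SucI) (use dyadic_grid_mono in \<open>fastforce simp: stays_grid_def\<close>)
qed

definition survives :: "'a set \<Rightarrow> 'a \<Rightarrow> real \<Rightarrow> 'w set" where
  "survives D x u = {\<omega> \<in> space M. exit_time D (\<lambda>s. x + B s \<omega>) > ereal u}"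

lemma survives_iff:
  assumes "open D" "u \<ge> 0"
  shows "survives D x u = {\<omega> \<in> space M. \<forall>s\<in>{0..u}. x + B s \<omega> \<in> D}"
  unfolding survives_def using assms
  by (intro Collect_cong conj_cong refl exit_time_gt_iff continuous_intros B_cont) auto

text \<open>A surviving path up to u is a compact subset of D and so keeps a positive distance from
  the complement; any \<open>1 / Suc m\<close> below this distance serves.\<close>

lemma survives_eq_Union:
  assumes D: "open D" and u: "u \<ge> 0"
  shows "survives D x u = (\<Union>m. stays (inner_set D x m) u)"
proof (intro equalityI subsetI)
  fix \<omega> assume "\<omega> \<in> survives D x u"
  hence w: "\<omega> \<in> space M" "\<forall>s\<in>{0..u}. x + B s \<omega> \<in> D" using survives_iff[OF D u] by auto
  have "compact ((\<lambda>s. x + B s \<omega>) ` {0..u})"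
    by (intro compact_continuous_image continuous_intros continuous_on_subset[OF B_cont[OF w(1)]]) auto
  moreover have "(\<lambda>s. x + B s \<omega>) ` {0..u} \<subseteq> D" using w(2) by auto
  ultimately obtain e where e: "e > 0" "(\<Union>y\<in>(\<lambda>s. x + B s \<omega>) ` {0..u}. ball y e) \<subseteq> D"
    using compact_subset_open_imp_ball_epsilon_subset[OF _ D] by blast
  obtain m where m: "1 / Suc m < e" using e(1) nat_approx_posE by blast
  have "B s \<omega> \<in> inner_set D x m" if "s \<in> {0..u}" for s
  proof -
    have "ball (x + B s \<omega>) (1 / Suc m) \<subseteq> ball (x + B s \<omega>) e" using m by (intro subset_ball) simp
    thus ?thesis using e(2) that unfolding inner_set_def by blast
  qed
  hence "\<omega> \<in> stays (inner_set D x m) u" using w(1) by (simp add: stays_def)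
  thus "\<omega> \<in> (\<Union>m. stays (inner_set D x m) u)" by (rule UN_I[OF UNIV_I])
next
  fix \<omega> assume "\<omega> \<in> (\<Union>m. stays (inner_set D x m) u)"
  then obtain m where "\<omega> \<in> stays (inner_set D x m) u" by (rule UN_E)
  hence m: "\<omega> \<in> space M" "\<And>s. s \<in> {0..u} \<Longrightarrow> B s \<omega> \<in> inner_set D x m"
    by (auto simp: stays_def)
  have "x + B s \<omega> \<in> D" if "s \<in> {0..u}" for s
  proof -
    have "x + B s \<omega> \<in> ball (x + B s \<omega>) (1 / Suc m)" by simp
    thus ?thesis using m(2)[OF that] unfolding inner_set_def by blast
  qed
  thus "\<omega> \<in> survives D x u" using survives_iff[OF D u] m(1) by auto
qed

lemma survives_path_algebra:
  assumes "open D" "u \<ge> 0"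
  shows "survives D x u \<in> sets path_algebra"
  unfolding survives_eq_Union[OF assms]
  by (intro sets.countable_UN'' stays_path_algebra closed_inner_set assms) auto

lemma stays_survives_tendsto:
  assumes "open D" "u \<ge> 0"
  shows "(\<lambda>m. prob (stays (inner_set D x m) u)) \<longlonglongrightarrow> prob (survives D x u)"
  unfolding survives_eq_Union[OF assms]
proof (rule finite_Lim_measure_incseq)
  show "range (\<lambda>m. stays (inner_set D x m) u) \<subseteq> sets M"
    by (intro image_subsetI subsetD[OF path_algebra_subset] stays_path_algebra closed_inner_set assms)
  show "incseq (\<lambda>m. stays (inner_set D x m) u)"
    using inner_set_mono[of D x] unfolding incseq_def stays_def by blast
qed

text \<open>Grid values are partial sums of independent Gaussian increments. The right-hand side
  mentions neither M nor B, so it is the same for every Brownian motion.\<close>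

lemma grid_law:
  assumes h: "h > 0" and K: "K \<in> sets borel" and n: "n > 0"
  shows "prob {\<omega> \<in> space M. \<forall>i\<in>{..n}. B (real i * h) \<omega> \<in> K} =
       measure (Pi\<^sub>M {..<n} (\<lambda>_. density lborel (\<lambda>y. ennreal (gauss_kernel h (y :: 'a)))))
         {f \<in> space (Pi\<^sub>M {..<n} (\<lambda>_. borel)). \<forall>i\<in>{..n}. (\<Sum>j<i. f j) \<in> K}"
proof -
  define X where "X = (\<lambda>i \<omega>. B (real (Suc i) * h) \<omega> - B (real i * h) \<omega>)"
  define ts where "ts = map (\<lambda>i. real i * h) [0..<Suc n]"
  have srt: "sorted_wrt (<) ts"
    unfolding ts_def sorted_wrt_map by (rule sorted_wrt_mono_rel[OF _ sorted_wrt_upt]) (use h in auto)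
  have "indep_vars (\<lambda>_. borel) (\<lambda>i \<omega>. B (ts ! Suc i) \<omega> - B (ts ! i) \<omega>) {..<length ts - 1}"
    by (rule B_indep[OF srt]) (use h in \<open>auto simp: ts_def\<close>)
  also have "length ts - 1 = n" by (simp add: ts_def)
  also have "indep_vars (\<lambda>_. borel) (\<lambda>i \<omega>. B (ts ! Suc i) \<omega> - B (ts ! i) \<omega>) {..<n} \<longleftrightarrow>
      indep_vars (\<lambda>_. borel) X {..<n}"
    by (rule indep_vars_cong) (auto simp: ts_def X_def nth_append fun_eq_iff simp del: upt_Suc)
  finally have ind: "indep_vars (\<lambda>_. borel) X {..<n}" .
  have rvX: "random_variable borel (X i)" for i using h by (simp add: X_def)
  have dX: "distr M borel (X i) = density lborel (\<lambda>y. ennreal (gauss_kernel h y))" for i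
  proof -
    have "real i * h < real (Suc i) * h" "0 \<le> real i * h" using h by auto
    from B_incr[OF this(2,1)]
    have "distributed M lborel (X i) (\<lambda>y. ennreal (gauss_kernel (real (Suc i) * h - real i * h) y))"
      unfolding X_def .
    also have "real (Suc i) * h - real i * h = h" by (simp add: algebra_simps)
    finally have "distr M lborel (X i) = density lborel (\<lambda>y. ennreal (gauss_kernel h y))"
      by (simp add: distributed_distr_eq_density)
    moreover have "distr M lborel (X i) = distr M borel (X i)" by (rule distr_cong) auto
    ultimately show ?thesis by simp
  qed
  define E where "E = {f \<in> space (Pi\<^sub>M {..<n} (\<lambda>_. borel)). \<forall>i\<in>{..n}. (\<Sum>j<i. f j) \<in> K}"
  have E: "E \<in> sets (Pi\<^sub>M {..<n} (\<lambda>_. borel))"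
    unfolding E_def using K
    by (intro sets.sets_Collect_finite_All sets_Collect_mem[where L = borel] borel_measurable_sum
        measurable_component_singleton) auto
  have tele: "(\<Sum>j<i. X j \<omega>) = B (real i * h) \<omega>" if "\<omega> \<in> space M" for i \<omega>
    using that by (induction i) (auto simp: B_zero X_def)
  have "{\<omega> \<in> space M. \<forall>i\<in>{..n}. B (real i * h) \<omega> \<in> K} =
      (\<lambda>\<omega>. \<lambda>i\<in>{..<n}. X i \<omega>) -` E \<inter> space M"
    by (auto simp: E_def space_PiM tele)
  hence "prob {\<omega> \<in> space M. \<forall>i\<in>{..n}. B (real i * h) \<omega> \<in> K} =
      measure (distr M (Pi\<^sub>M {..<n} (\<lambda>_. borel)) (\<lambda>\<omega>. \<lambda>i\<in>{..<n}. X i \<omega>)) E"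
    using E rvX by (subst measure_distr) (auto intro!: measurable_restrict)
  also have "distr M (Pi\<^sub>M {..<n} (\<lambda>_. borel)) (\<lambda>\<omega>. \<lambda>i\<in>{..<n}. X i \<omega>) =
      Pi\<^sub>M {..<n} (\<lambda>i. distr M borel (X i))"
    using indep_vars_iff_distr_eq_PiM'[of "{..<n}" X "\<lambda>_. borel"] ind rvX n by auto
  finally show ?thesis unfolding dX E_def .
qed

end

text \<open>Equality of grid probabilities passes to closed sets by the decreasing limit over grids,
  and to D by the increasing limit over \<open>inner_set\<close>.\<close>

lemma survives_law_eq:
  fixes M :: "'w measure" and B B' :: "real \<Rightarrow> 'w \<Rightarrow> 'a::euclidean_space"
  assumes "brownian M B" "brownian M B'" and D: "open D" and u: "u \<ge> 0"
  shows "measure M (brownian.survives M B D x u) = measure M (brownian.survives M B' D x u)"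
proof -
  interpret B: brownian M B by fact
  interpret B': brownian M B' by fact
  have grid: "measure M (B.stays_grid K u k) = measure M (B'.stays_grid K u k)"
    if K: "K \<in> sets borel" and u: "u > 0" for K k
  proof -
    have h: "u / 2 ^ k > 0" using u by simp
    show ?thesis
      using B.grid_law[OF h K, of "2 ^ k"] B'.grid_law[OF h K, of "2 ^ k"]
      by (simp add: B.stays_grid_def B'.stays_grid_def dyadic_grid_def)
  qed
  \<comment> \<open>At \<open>u = 0\<close> the mesh vanishes and \<open>grid_law\<close> does not
    apply; all grid times are then 0, where both motions are 0.\<close>
  have zero: "measure M (B.stays_grid K 0 k) = measure M (B'.stays_grid K 0 k)" for K k
    by (auto simp: B.stays_grid_def B'.stays_grid_def dyadic_grid_def B.B_zero B'.B_zero intro!: arg_cong[where f="measure M"])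
  have stays: "measure M (B.stays K u) = measure M (B'.stays K u)" if K: "closed K" for K
  proof -
    have "measure M (B.stays_grid K u k) = measure M (B'.stays_grid K u k)" for k
      using grid[of K k] zero[of K k] u K by (cases "u = 0") auto
    thus ?thesis
      using LIMSEQ_unique[OF B.stays_grid_tendsto[OF K u]] B'.stays_grid_tendsto[OF K u] by simp
  qed
  show ?thesis
    using LIMSEQ_unique[OF B.stays_survives_tendsto[OF D u, of x]] B'.stays_survives_tendsto[OF D u, of x]
    by (simp add: stays closed_inner_set)
qed

section \<open>The iterated process\<close>

lemma continuous_on_two_sided:
  fixes f g :: "real \<Rightarrow> 'a::topological_space"
  assumes "continuous_on {0..} f" "continuous_on {0..} g" "f 0 = g 0"
  shows "continuous_on UNIV (\<lambda>r. if r \<ge> 0 then f r else g (- r))"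
proof -
  have "continuous_on {..0} (\<lambda>r. g (- r))"
    by (rule continuous_on_compose2[OF assms(2)]) (auto intro!: continuous_intros)
  hence "continuous_on ({0..} \<union> {..0}) (\<lambda>r. if r \<ge> 0 then f r else g (- r))"
    using assms by (intro continuous_on_cases) auto
  moreover have "{0..} \<union> {..0} = (UNIV :: real set)" by auto
  ultimately show ?thesis by simp
qed

text \<open>By the intermediate value theorem y takes every level between its minimum and maximum,
  so f and g are tested on full intervals. The slack from openness replaces the extrema by rational
  levels, which makes the union over levels countable.\<close>

lemma two_sided_in_iff:
  fixes f g :: "real \<Rightarrow> 'a::topological_space" and y :: "real \<Rightarrow> real"
  assumes f: "continuous_on {0..} f" and g: "continuous_on {0..} g" and fg: "f 0 = g 0"
    and y: "continuous_on {0..} y" and y0: "y 0 = 0" and D: "open D" and t: "t \<ge> 0"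
  shows "(\<forall>s\<in>{0..t}. (if y s \<ge> 0 then f (y s) else g (- y s)) \<in> D) \<longleftrightarrow>
    (\<exists>a\<in>\<rat> \<inter> {0..}. \<exists>b\<in>\<rat> \<inter> {0..}. (\<forall>s\<in>{0..t}. y s \<in> {-b..a}) \<and>
       (\<forall>r\<in>{0..a}. f r \<in> D) \<and> (\<forall>r\<in>{0..b}. g r \<in> D))"
    (is "?L \<longleftrightarrow> ?R")
proof
  assume ?R
  then obtain a b where "\<forall>s\<in>{0..t}. y s \<in> {-b..a}" "\<forall>r\<in>{0..a}. f r \<in> D" "\<forall>r\<in>{0..b}. g r \<in> D" by blast
  thus ?L by fastforce
next
  assume L: ?L
  have yt: "continuous_on {0..t} y" by (rule continuous_on_subset[OF y]) auto
  have ne: "{0..t} \<noteq> {}" using t by auto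
  obtain s1 where s1: "s1 \<in> {0..t}" "\<And>s. s \<in> {0..t} \<Longrightarrow> y s \<le> y s1"
    using continuous_attains_sup[OF compact_Icc ne yt] by blast
  obtain s2 where s2: "s2 \<in> {0..t}" "\<And>s. s \<in> {0..t} \<Longrightarrow> y s2 \<le> y s"
    using continuous_attains_inf[OF compact_Icc ne yt] by blast
  have nn: "y s1 \<ge> 0" "y s2 \<le> 0" using s1(2)[of 0] s2(2)[of 0] y0 t by auto
  have conn: "is_interval (y ` {0..t})"
    using connected_continuous_image[OF yt] by (simp add: is_interval_connected_1)
  have im: "r \<in> y ` {0..t}" if "y s2 \<le> r" "r \<le> y s1" for r
    using mem_is_interval_1_I[OF conn _ _ that] s1(1) s2(1) by blast
  have fD: "\<forall>r\<in>{0..y s1}. f r \<in> D"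
  proof
    fix r assume r: "r \<in> {0..y s1}"
    then obtain s where s: "s \<in> {0..t}" "r = y s" using im[of r] nn by auto
    have "(if y s \<ge> 0 then f (y s) else g (- y s)) \<in> D" using L s(1) by blast
    thus "f r \<in> D" using r s(2) by simp
  qed
  have gD: "\<forall>r\<in>{0..- y s2}. g r \<in> D"
  proof
    fix r assume r: "r \<in> {0..- y s2}"
    then obtain s where s: "s \<in> {0..t}" "- r = y s" using im[of "- r"] nn by auto
    have "(if y s \<ge> 0 then f (y s) else g (- y s)) \<in> D" using L s(1) by blast
    \<comment> \<open>At \<open>r = 0\<close> the branch for f is taken, and
      \<open>f 0 = g 0\<close> is needed.\<close>
    moreover have "(if y s \<ge> 0 then f (y s) else g (- y s)) = g r"
    proof -
      have "y s = - r" using s(2) by simp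
      thus ?thesis using r fg by (cases "r = 0") auto
    qed
    ultimately show "g r \<in> D" by simp
  qed
  obtain e1 where e1: "e1 > 0" "\<forall>r\<in>{0..y s1 + e1}. f r \<in> D"
    using stays_in_open_extend[OF f D nn(1) fD] .
  obtain e2 where e2: "e2 > 0" "\<forall>r\<in>{0..- y s2 + e2}. g r \<in> D"
    using stays_in_open_extend[OF g D _ gD] nn(2) by auto
  obtain a where a: "a \<in> \<rat>" "y s1 < a" "a < y s1 + e1" using Rats_dense_in_real[of "y s1" "y s1 + e1"] e1 by auto
  obtain b where b: "b \<in> \<rat>" "- y s2 < b" "b < - y s2 + e2" using Rats_dense_in_real[of "- y s2" "- y s2 + e2"] e2 by auto
  show ?R
  proof (rule bexI[of _ a], rule bexI[of _ b], intro conjI ballI)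
    fix s assume s: "s \<in> {0..t}"
    show "y s \<in> {-b..a}" using s1(2)[OF s] s2(2)[OF s] a b by auto
  qed (use a b e1 e2 nn in auto)
qed

text \<open>The asymptotics control only \<open>u \<ge> U\<close>. Between 1 and \<open>U\<close>,
  monotonicity gives \<open>g u \<ge> g U\<close> and the upper bound is the trivial
  \<open>g u \<le> 1\<close>, so adjusting the constants extends both bounds down to 1.\<close>

lemma survival_power_bounds:
  fixes g :: "real \<Rightarrow> real"
  assumes asym: "g \<sim>[at_top] (\<lambda>t. C * t powr (- p))" and C: "C > 0"
    and mono: "\<And>u v. 0 \<le> u \<Longrightarrow> u \<le> v \<Longrightarrow> g v \<le> g u" and le1: "\<And>u. g u \<le> 1" and p: "p > 0"
  obtains c K where "c > 0" "K \<ge> 1" "\<And>u. u \<ge> 1 \<Longrightarrow> c * u powr (- p) \<le> g u"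
    "\<And>u. u \<ge> 1 \<Longrightarrow> g u \<le> K * u powr (- p)"
proof -
  have "((\<lambda>t. if g t = 0 \<and> C * t powr (- p) = 0 then 1 else g t / (C * t powr (- p))) \<longlongrightarrow> 1) at_top"
    using asym unfolding asymp_equiv_def .
  hence "eventually (\<lambda>t. dist (if g t = 0 \<and> C * t powr (- p) = 0 then 1 else g t / (C * t powr (- p))) 1 < 1 / 2) at_top"
    by (rule tendstoD) simp
  then obtain T where T: "\<And>t. t \<ge> T \<Longrightarrow> dist (if g t = 0 \<and> C * t powr (- p) = 0 then 1 else g t / (C * t powr (- p))) 1 < 1 / 2"
    unfolding eventually_at_top_linorder by blast
  define U where "U = max T 1"
  have U: "U \<ge> 1" by (simp add: U_def)
  have b: "C / 2 * u powr (- p) \<le> g u \<and> g u \<le> 2 * C * u powr (- p)" if "u \<ge> U" for u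
  proof -
    have pos: "C * u powr (- p) > 0" using C that U by simp
    hence "\<bar>g u / (C * u powr (- p)) - 1\<bar> < 1 / 2" using T[of u] that C by (simp add: U_def dist_real_def)
    hence q: "1 / 2 < g u / (C * u powr (- p))" "g u / (C * u powr (- p)) < 3 / 2" by linarith+
    have "1 / 2 * (C * u powr (- p)) < g u" "g u < 3 / 2 * (C * u powr (- p))"
      using q(1)[unfolded pos_less_divide_eq[OF pos]] q(2)[unfolded pos_divide_less_eq[OF pos]] .
    thus ?thesis using pos by (simp add: algebra_simps)
  qed
  have pow1: "u powr (- p) \<le> 1" if "u \<ge> 1" for u using that p by (simp add: powr_minus ge_one_powr_ge_zero divide_simps)
  have powU: "U powr (- p) \<le> u powr (- p)" if "1 \<le> u" "u \<le> U" for u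
    using that p by (intro powr_mono2') auto
  \<comment> \<open>\<open>c\<close> is a lower bound for \<open>g U\<close>; the entry
    \<open>1 / U powr (- p)\<close> in \<open>K\<close> makes \<open>K * u powr (- p)\<close> at
    least one for \<open>1 \<le> u \<le> U\<close>.\<close>
  define c where "c = C / 2 * U powr (- p)"
  define K where "K = max (max 1 (2 * C)) (1 / U powr (- p))"
  have UU: "U powr (- p) > 0" using U by simp
  show ?thesis
  proof (rule that[of c K])
    show "c > 0" using C UU by (simp add: c_def)
    show "K \<ge> 1" by (simp add: K_def)
    fix u :: real assume u: "u \<ge> 1"
    show "c * u powr (- p) \<le> g u"
    proof (cases "u \<ge> U")
      case True
      have "c * u powr (- p) \<le> C / 2 * u powr (- p)"
        unfolding c_def using pow1[OF U] C by (intro mult_right_mono) auto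
      thus ?thesis using b[OF True] by linarith
    next
      case False
      have "c * u powr (- p) \<le> c * 1" using pow1[OF u] \<open>c > 0\<close> by (intro mult_left_mono) auto
      also have "\<dots> \<le> g U" using b[of U] by (simp add: c_def)
      also have "\<dots> \<le> g u" using False u by (intro mono) auto
      finally show ?thesis .
    qed
    show "g u \<le> K * u powr (- p)"
    proof (cases "u \<ge> U")
      case True
      have "2 * C * u powr (- p) \<le> K * u powr (- p)" by (intro mult_right_mono) (auto simp: K_def)
      thus ?thesis using b[OF True] by linarith
    next
      case False
      have "1 = 1 / U powr (- p) * U powr (- p)" using UU by simp
      also have "\<dots> \<le> K * u powr (- p)"
        using powU[OF u] False UU by (intro mult_mono) (auto simp: K_def)
      finally show ?thesis using le1[of u] by linarith
    qed
  qed
qed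

section \<open>Strip probabilities in continuous time\<close>

context real_brownian
begin

text \<open>The bound \<open>a\<close> is used on the first half of \<open>[0, t]\<close>, the bound \<open>b\<close> only at \<open>N + 1\<close> times in
  the second half.\<close>

lemma stays_upper:
  fixes K :: "real set"
  assumes t: "t > 0" and a: "a \<ge> 1" and b: "b \<ge> 0" and K: "K \<subseteq> {..a}" and KN: "N = 0 \<or> K \<subseteq> {-b..b}"
  shows "prob (stays K t) \<le> 6 * (3 * sqrt (real N)) ^ N * (a / sqrt t) * (b / sqrt t) ^ N"
proof -
  define s where "s = t / 2"
  have s: "s > 0" using t by (simp add: s_def)
  define d where "d = (if N = 0 then 1 else s / N)"
  have d: "d > 0" using s by (simp add: d_def)
  \<comment> \<open>With n steps on \<open>[0, s]\<close> the overshoot error is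
    \<open>6 * s\<^sup>2 / n\<close>; this choice makes it at most
    \<open>a / sqrt s\<close>.\<close>
  obtain n0 :: nat where n0: "real n0 \<ge> 6 * s\<^sup>2 * sqrt s" using real_arch_simple by blast
  define n where "n = Suc n0"
  have n: "n > 0" "real n \<ge> 6 * s\<^sup>2 * sqrt s" using n0 by (auto simp: n_def)
  define h where "h = s / n"
  have h: "h > 0" "real n * h = s" using s n by (auto simp: h_def)
  define A where "A = {\<omega> \<in> space M. \<forall>i\<in>{..n}. B (real i * h) \<omega> \<in> {..a}}"
  have A: "past_event s A" unfolding A_def by (rule past_event_grid(1)) (use h in auto)
  have [measurable]: "A \<in> sets M" by (rule past_event_sets[OF A])
  have "prob A \<le> prob {\<omega> \<in> space M. \<bar>B s \<omega>\<bar> \<le> a + 1} + 6 * real n * h\<^sup>2"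
    using max_grid_upper[OF h(1) n(1), of a] a unfolding A_def h(2) by simp
  also have "prob {\<omega> \<in> space M. \<bar>B s \<omega>\<bar> \<le> a + 1} \<le> (a + 1) / sqrt s"
    using s a by (intro normal_prob_abs_le[OF B_normal]) auto
  also have "6 * real n * h\<^sup>2 = 6 * s\<^sup>2 / n" using n by (simp add: h_def power2_eq_square)
  also have "6 * s\<^sup>2 / n \<le> a / sqrt s"
  proof -
    have "6 * s\<^sup>2 * sqrt s \<le> a * n" using n(2) a mult_right_mono[OF a, of "real n"] by linarith
    thus ?thesis using n(1) s by (simp add: field_simps)
  qed
  \<comment> \<open>Here \<open>a \<ge> 1\<close> absorbs the unit overshoot.\<close>
  also have "(a + 1) / sqrt s + a / sqrt s \<le> 3 * a / sqrt s"
    using a s unfolding add_divide_distrib[symmetric] by (intro divide_right_mono) auto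
  also have "3 * a / sqrt s = 3 * sqrt 2 * (a / sqrt t)" by (simp add: s_def real_sqrt_divide)
  also have "\<dots> \<le> 6 * (a / sqrt t)"
  proof -
    have "sqrt 2 \<le> 2" by (rule real_le_lsqrt) auto
    thus ?thesis using a t by (intro mult_right_mono) auto
  qed
  finally have pA: "prob A \<le> 6 * (a / sqrt t)" by simp
  define F where "F = A \<inter> {\<omega> \<in> space M. \<forall>j\<in>{..N}. \<bar>B (s + real j * d) \<omega>\<bar> \<le> b}"
  show ?thesis
  proof (cases "N = 0")
    case True
    have "stays K t \<subseteq> A"
    proof
      fix \<omega> assume w: "\<omega> \<in> stays K t"
      have "B (real i * h) \<omega> \<in> {..a}" if "i \<le> n" for i
      proof -
        have "real i * h \<le> s" unfolding h(2)[symmetric] using that h(1) by (intro mult_right_mono) auto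
        hence "real i * h \<in> {0..t}" using h(1) t by (auto simp: s_def)
        thus ?thesis using w K unfolding stays_def by blast
      qed
      thus "\<omega> \<in> A" using w by (auto simp: A_def stays_def)
    qed
    hence "prob (stays K t) \<le> prob A" by (intro finite_measure_mono) auto
    thus ?thesis using pA True by simp
  next
    case False
    have dN: "real N * d = s" using False by (simp add: d_def)
    have Fm: "F \<in> sets M"
    proof -
      have "past_event (s + real N * d) F"
        unfolding F_def
      proof (intro past_event_Int past_event_Ball)
        show "past_event (s + real N * d) A" by (rule past_event_mono[OF A]) (use dN s in auto)
        fix j assume j: "j \<in> {..N}"
        have "{\<omega> \<in> space M. \<bar>B (s + real j * d) \<omega>\<bar> \<le> b} = {\<omega> \<in> space M. B (s + real j * d) \<omega> \<in> {-b..b}}" by auto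
        moreover have "real j * d \<le> real N * d" using j d by (intro mult_right_mono) auto
        ultimately show "past_event (s + real N * d) {\<omega> \<in> space M. \<bar>B (s + real j * d) \<omega>\<bar> \<le> b}"
          using s d by (simp only:) (intro past_event_single, auto)
      qed (use s dN in auto)
      thus ?thesis by (rule past_event_sets)
    qed
    have "stays K t \<subseteq> F"
    proof
      fix \<omega> assume w: "\<omega> \<in> stays K t"
      have 1: "B (real i * h) \<omega> \<in> {..a}" if "i \<le> n" for i
      proof -
        have "real i * h \<le> s" unfolding h(2)[symmetric] using that h(1) by (intro mult_right_mono) auto
        hence "real i * h \<in> {0..t}" using h(1) t by (auto simp: s_def)
        thus ?thesis using w K unfolding stays_def by blast
      qed
      have 2: "\<bar>B (s + real j * d) \<omega>\<bar> \<le> b" if "j \<le> N" for j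
      proof -
        have "real j * d \<le> s" unfolding dN[symmetric] using that d by (intro mult_right_mono) auto
        hence "s + real j * d \<in> {0..t}" using d s by (auto simp: s_def)
        hence "B (s + real j * d) \<omega> \<in> {-b..b}" using w KN False unfolding stays_def by blast
        thus ?thesis by auto
      qed
      show "\<omega> \<in> F" using w 1 2 by (auto simp: A_def F_def stays_def)
    qed
    hence "prob (stays K t) \<le> prob F" using Fm by (intro finite_measure_mono) auto
    also have "\<dots> \<le> prob A * (2 * b / sqrt d) ^ N"
      unfolding F_def by (rule block_bound[OF A]) (use s d b in auto)
    \<comment> \<open>The N blocks share the second half of the time, so
      \<open>d = t / (2 * N)\<close>; the factor \<open>2 * sqrt 2\<close> is then rounded up to
      3.\<close>
    also have "2 * b / sqrt d = 2 * sqrt 2 * sqrt N * (b / sqrt t)"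
      using False t by (simp add: d_def s_def real_sqrt_divide real_sqrt_mult)
    also have "prob A * (2 * sqrt 2 * sqrt N * (b / sqrt t)) ^ N \<le> 6 * (a / sqrt t) * (3 * sqrt N * (b / sqrt t)) ^ N"
    proof (intro mult_mono pA power_mono mult_right_mono)
      have "sqrt 2 \<le> 3 / 2" by (rule real_le_lsqrt) (auto simp: power2_eq_square)
      thus "2 * sqrt 2 \<le> 3" by simp
    qed (use a b t in auto)
    finally show ?thesis by (simp only: power_mult_distrib mult_ac)
  qed
qed

text \<open>The maximum stays below \<open>a\<close> with probability at least
  \<open>a / (3 * sqrt t)\<close>, and exit through \<open>- L\<close> costs at most
  \<open>(a + 1) / L \<le> 2 * a / L\<close> once the grid error vanishes. With
  \<open>L = 12 * sqrt t\<close> the cost is half of the gain.\<close>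

lemma stays_lower:
  assumes t: "t > 0" and a: "1 \<le> a" "a \<le> sqrt t"
  shows "prob (stays {- (12 * sqrt t)..a} t) \<ge> a / (6 * sqrt t)"
proof -
  define L where "L = 12 * sqrt t"
  have L: "L > 0" using t by (simp add: L_def)
  have "(\<lambda>k. a / (3 * sqrt t) - (a + 1 + 3 * t\<^sup>2 * (1 / 2) ^ k) / L) \<longlonglongrightarrow> a / (3 * sqrt t) - (a + 1 + 3 * t\<^sup>2 * 0) / L"
    using L by (intro tendsto_diff tendsto_const tendsto_divide tendsto_add tendsto_mult LIMSEQ_realpow_zero) auto
  moreover have "(\<lambda>k. prob (stays_grid {-L..a} t k)) \<longlonglongrightarrow> prob (stays {-L..a} t)"
    by (rule stays_grid_tendsto) (use t in auto)
  moreover have "a / (3 * sqrt t) - (a + 1 + 3 * t\<^sup>2 * (1 / 2) ^ k) / L \<le> prob (stays_grid {-L..a} t k)" for k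
  proof -
    define h where "h = t / 2 ^ k"
    have h: "h > 0" "real (2 ^ k) * h = t" using t by (auto simp: h_def)
    have "real (2 ^ k) * h\<^sup>2 = t\<^sup>2 * (1 / 2) ^ k"
      using t by (simp add: h_def power2_eq_square power_one_over)
    hence e: "3 * real (2 ^ k) * h\<^sup>2 = 3 * t\<^sup>2 * (1 / 2) ^ k" by (simp only: mult.assoc)
    have "a / (3 * sqrt t) \<le> prob {\<omega> \<in> space M. \<bar>B t \<omega>\<bar> \<le> a}"
      using t a by (intro normal_prob_abs_ge[OF B_normal]) auto
    moreover have "prob {\<omega> \<in> space M. \<forall>i\<in>{..2 ^ k}. B (real i * h) \<omega> \<in> {-L..a}}
      \<ge> prob {\<omega> \<in> space M. \<bar>B (real (2 ^ k) * h) \<omega>\<bar> \<le> a} - (a + 1 + 3 * real (2 ^ k) * h\<^sup>2) / L"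
      by (rule strip_grid_lower) (use h L a in auto)
    moreover have "prob (stays_grid {-L..a} t k) = prob {\<omega> \<in> space M. \<forall>i\<in>{..2 ^ k}. B (real i * h) \<omega> \<in> {-L..a}}"
      by (simp add: stays_grid_def dyadic_grid_def h_def)
    ultimately show ?thesis unfolding h(2) e by linarith
  qed
  ultimately have "a / (3 * sqrt t) - (a + 1 + 3 * t\<^sup>2 * 0) / L \<le> prob (stays {-L..a} t)"
    by (intro LIMSEQ_le) auto
  moreover have "(a + 1 + 3 * t\<^sup>2 * 0) / L \<le> a / (6 * sqrt t)"
    using a t by (simp add: L_def field_simps)
  moreover have "a / (3 * sqrt t) = a / (6 * sqrt t) + a / (6 * sqrt t)" by (simp add: field_simps)
  ultimately show ?thesis unfolding L_def by linarith
qed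

end

text \<open>Negating \<open>Y\<close> swaps its two extrema, so a box whose smaller bound is on the
  negative side needs no separate estimate.\<close>

lemma brownian_motion_uminus:
  fixes B :: "real \<Rightarrow> 'w \<Rightarrow> real"
  assumes "brownian_motion M B"
  shows "brownian_motion M (\<lambda>t \<omega>. - B t \<omega>)"
proof -
  interpret real_brownian M B
    using brownianI[OF assms] by (simp add: real_brownian_def)
  show ?thesis
    unfolding brownian_motion_def
  proof (intro conjI allI impI ballI)
    show "prob_space M" by unfold_locales
    fix s t :: real assume st: "0 \<le> s \<and> s < t"
    have "distributed M lborel (\<lambda>\<omega>. 0 + (-1) * (B t \<omega> - B s \<omega>)) (normal_density (0 + (-1) * 0) (\<bar>-1\<bar> * sqrt (t - s)))"
      by (rule normal_density_affine[OF incr_normal]) (use st in auto)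
    moreover have "(\<lambda>y :: real. ennreal (gauss_kernel (t - s) y)) = (\<lambda>y. ennreal (normal_density 0 (sqrt (t - s)) y))"
      using st by (simp add: gauss_kernel_real)
    ultimately show "distributed M lborel (\<lambda>\<omega>. - B t \<omega> - - B s \<omega>) (\<lambda>y. ennreal (gauss_kernel (t - s) y))"
      by simp
  next
    fix ts :: "real list" assume ts: "sorted_wrt (<) ts \<and> (\<forall>t\<in>set ts. 0 \<le> t)"
    have "indep_vars (\<lambda>_. borel) (\<lambda>i. (\<lambda>x. - x) \<circ> (\<lambda>\<omega>. B (ts ! Suc i) \<omega> - B (ts ! i) \<omega>)) {..<length ts - 1}"
      by (rule indep_vars_compose[OF B_indep]) (use ts in auto)
    thus "indep_vars (\<lambda>_. borel) (\<lambda>i \<omega>. - B (ts ! Suc i) \<omega> - - B (ts ! i) \<omega>) {..<length ts - 1}"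
      by (simp add: o_def)
  qed (use B_zero B_cont in \<open>auto intro!: continuous_intros\<close>)
qed

section \<open>Dyadic ranges for the two extrema\<close>

lemma two_power_powr: "(2 ^ n) powr a = (2 powr a :: real) ^ n"
  by (induction n) (auto simp: powr_mult)

text \<open>Summation by parts with \<open>w ^ i - w ^ Suc i = (1 - w) * w ^ i\<close>. For
  \<open>0 < w < 1\<close> and nonnegative f, lower bounds on the partial sums of f become a lower
  bound on the weighted sum.\<close>

lemma abel_geometric:
  fixes f :: "nat \<Rightarrow> real"
  shows "(1 - w) * (\<Sum>i\<le>J. w ^ i * (\<Sum>j\<le>i. f j)) + w ^ Suc J * (\<Sum>j\<le>J. f j) = (\<Sum>j\<le>J. f j * w ^ j)"
proof (induction J)
  case (Suc J)
  have "(1 - w) * (\<Sum>i\<le>Suc J. w ^ i * (\<Sum>j\<le>i. f j)) + w ^ Suc (Suc J) * (\<Sum>j\<le>Suc J. f j) =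
    ((1 - w) * (\<Sum>i\<le>J. w ^ i * (\<Sum>j\<le>i. f j)) + w ^ Suc J * (\<Sum>j\<le>J. f j)) + f (Suc J) * w ^ Suc J"
    by (simp add: algebra_simps)
  thus ?case unfolding Suc by simp
qed (simp add: algebra_simps)

context real_brownian
begin

text \<open>Index J means that no bound is imposed on that side. Since
  \<open>2 ^ J / sqrt t \<ge> 1 / 2\<close>, each missing factor costs at most 2, which the factor
  \<open>2 ^ Suc N\<close> pays for. The small ball bound is used when \<open>k < J\<close>, the
  one-sided bound when \<open>i < k = J\<close>, and the trivial bound 1 when both are J.\<close>

lemma dyadic_strip_prob:
  fixes K :: "real set"
  assumes t: "t > 0" and J: "sqrt t \<le> 2 ^ Suc J" and ik: "i \<le> k" "k \<le> J"
    and K: "i < J \<Longrightarrow> K \<subseteq> {..2 ^ i}" "k < J \<Longrightarrow> K \<subseteq> {- (2 ^ k)..}"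
  shows "prob (stays K t) \<le> (6 * (3 * sqrt (real N)) ^ N + 6) * 2 ^ Suc N * (2 ^ i / sqrt t * (2 ^ k / sqrt t) ^ N)"
proof -
  define A where "A = 6 * (3 * sqrt (real N)) ^ N"
  define u where "u = 2 ^ i / sqrt t"
  define v where "v = 2 ^ k / sqrt t"
  have A: "A \<ge> 0" by (simp add: A_def)
  have uv: "u > 0" "v > 0" using t by (auto simp: u_def v_def)
  have half: "1 / 2 \<le> 2 ^ J / sqrt t" using J t by (simp add: field_simps)
  have pw: "1 \<le> 2 * (2::real) ^ N" using one_le_power[of "2 :: real" "Suc N"] by (simp del: one_le_power)
  have vN: "2 ^ N * v ^ N \<ge> 1" if "k = J"
  proof -
    have "1 \<le> 2 * v" unfolding v_def that using half by linarith
    hence "1 \<le> (2 * v) ^ N" by (rule one_le_power)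
    thus ?thesis by (simp add: power_mult_distrib)
  qed
  have "prob (stays K t) \<le> (A + 6) * 2 ^ Suc N * (u * v ^ N)"
  proof (cases "k < J")
    case True
    have le: "(2 :: real) ^ i \<le> 2 ^ k" using ik by simp
    have iJ: "i < J" using True ik by simp
    have "K \<subseteq> {- (2 ^ k)..2 ^ k}"
    proof
      fix z assume z: "z \<in> K"
      have "z \<le> 2 ^ i" "- (2 ^ k) \<le> z" using subsetD[OF K(1)[OF iJ] z] subsetD[OF K(2)[OF True] z] by auto
      thus "z \<in> {- (2 ^ k)..2 ^ k}" using order_trans[OF _ le] by simp
    qed
    hence "prob (stays K t) \<le> A * u * v ^ N"
      unfolding A_def u_def v_def using K(1)[OF iJ] t by (intro stays_upper) auto
    also have "\<dots> = A * 1 * (u * v ^ N)" by simp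
    also have "\<dots> \<le> (A + 6) * 2 ^ Suc N * (u * v ^ N)"
      using A uv pw by (intro mult_right_mono mult_mono) auto
    finally show ?thesis .
  next
    case False
    hence k: "k = J" using ik by simp
    show ?thesis
    proof (cases "i < J")
      case True
      \<comment> \<open>With zero blocks only the one-sided bound remains; the value 0 for
        \<open>b\<close> is a placeholder whose power is 1.\<close>
      have "prob (stays K t) \<le> 6 * (3 * sqrt (real 0)) ^ 0 * (2 ^ i / sqrt t) * (0 / sqrt t) ^ 0"
        using K(1)[OF True] t by (intro stays_upper) auto
      also have "\<dots> = 6 * u * 1" by (simp add: u_def)
      also have "\<dots> \<le> 6 * u * (2 ^ N * v ^ N)" using vN[OF k] uv by (intro mult_left_mono) auto
      also have "\<dots> = 6 * 2 ^ N * (u * v ^ N)" by simp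
      also have "\<dots> \<le> (A + 6) * 2 ^ Suc N * (u * v ^ N)"
        using A uv by (intro mult_right_mono mult_mono) auto
      finally show ?thesis .
    next
      case False
      hence i: "i = J" using ik k by simp
      have "prob (stays K t) \<le> 1 * 1" by simp
      also have "\<dots> \<le> (2 * u) * (2 ^ N * v ^ N)"
      proof (rule mult_mono)
        show "1 \<le> 2 * u" unfolding u_def i using half by linarith
      qed (use vN[OF k] uv in auto)
      also have "\<dots> = 1 * 2 ^ Suc N * (u * v ^ N)" by simp
      also have "\<dots> \<le> (A + 6) * 2 ^ Suc N * (u * v ^ N)"
        using A uv by (intro mult_right_mono mult_mono) auto
      finally show ?thesis .
    qed
  qed
  thus ?thesis by (simp only: A_def u_def v_def)
qed

text \<open>Adding the bounds for both orders of i and k, instead of distinguishing them, makes each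
  summand a product of a function of i and one of k, so that the later double sum
  factorizes.\<close>

lemma dyadic_box_prob:
  assumes t: "t > 0" and J: "sqrt t \<le> 2 ^ Suc J" and ik: "i \<le> J" "k \<le> J"
  shows "prob (stays ((if k < J then {- (2 ^ k)..} else UNIV) \<inter> (if i < J then {..2 ^ i} else UNIV)) t) \<le>
    (6 * (3 * sqrt (real N)) ^ N + 6) * 2 ^ Suc N *
      (2 ^ i / sqrt t * (2 ^ k / sqrt t) ^ N + 2 ^ k / sqrt t * (2 ^ i / sqrt t) ^ N)"
    (is "prob (stays ?K t) \<le> ?c * (?f + ?g)")
proof -
  have c: "?c \<ge> 0" and fg: "?f \<ge> 0" "?g \<ge> 0" using t by auto
  show ?thesis
  proof (cases "i \<le> k")
    case True
    have "prob (stays ?K t) \<le> ?c * ?f"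
      by (rule dyadic_strip_prob[OF t J True ik(2)]) auto
    also have "\<dots> \<le> ?c * (?f + ?g)" using c fg by (intro mult_left_mono) auto
    finally show ?thesis .
  next
    case False
    interpret R: real_brownian M "\<lambda>t \<omega>. - B t \<omega>"
      using brownianI[OF brownian_motion_uminus[OF bm]] by (simp add: real_brownian_def)
    have "stays ?K t = R.stays (uminus ` ?K) t"
      unfolding stays_def R.stays_def by (intro Collect_cong conj_cong ball_cong refl) auto
    hence "prob (stays ?K t) = prob (R.stays (uminus ` ?K) t)" by simp
    also have "\<dots> \<le> ?c * ?g"
      by (rule R.dyadic_strip_prob[OF t J _ ik(1)]) (use False in auto)
    also have "\<dots> \<le> ?c * (?f + ?g)" using c fg by (intro mult_left_mono) auto
    finally show ?thesis .
  qed
qed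

end

section \<open>The survival probability of the iterated process\<close>

locale iterated_brownian = P: brownian M Xp + N: brownian M Xm + Y: real_brownian M Y
  for M :: "'w measure" and Xp Xm :: "real \<Rightarrow> 'w \<Rightarrow> 'a::euclidean_space" and Y :: "real \<Rightarrow> 'w \<Rightarrow> real" +
  fixes D :: "'a set" and x :: 'a
  assumes indep: "indep3 M Xp Xm Y" and D: "open D"
begin

lemma prob_indep3:
  assumes "A \<in> sets P.path_algebra" "B \<in> sets N.path_algebra" "C \<in> sets Y.path_algebra"
  shows "P.prob (A \<inter> B \<inter> C) = P.prob A * P.prob B * P.prob C"
proof -
  define E where "E i = (if i = 0 then A else if i = 1 then B else C)" for i :: nat
  have "P.prob (\<Inter>j\<in>{0, 1, 2}. E j) = (\<Prod>j\<in>{0, 1, 2}. P.prob (E j))"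
    by (rule P.indep_setsD[OF indep[unfolded indep3_def]])
      (use assms in \<open>auto simp: E_def P.path_algebra_def N.path_algebra_def Y.path_algebra_def\<close>)
  thus ?thesis by (simp add: E_def Int_ac mult.assoc)
qed

definition survival :: "real \<Rightarrow> 'w set" where
  "survival t = {\<omega> \<in> space M. exit_time D (\<lambda>s. iterated_bm Xp Xm Y x s \<omega>) > ereal t}"

lemma survival_iff:
  assumes t: "t \<ge> 0"
  shows "\<omega> \<in> survival t \<longleftrightarrow> \<omega> \<in> space M \<and>
    (\<forall>s\<in>{0..t}. (if Y s \<omega> \<ge> 0 then x + Xp (Y s \<omega>) \<omega> else x + Xm (- Y s \<omega>) \<omega>) \<in> D)"
proof (cases "\<omega> \<in> space M")
  case True
  have Z: "iterated_bm Xp Xm Y x s \<omega> =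
      (if Y s \<omega> \<ge> 0 then x + Xp (Y s \<omega>) \<omega> else x + Xm (- Y s \<omega>) \<omega>)" for s
    by (simp add: iterated_bm_def two_sided_def)
  have "continuous_on UNIV (\<lambda>r. if r \<ge> 0 then x + Xp r \<omega> else x + Xm (- r) \<omega>)"
    using True by (intro continuous_on_two_sided continuous_intros P.B_cont N.B_cont)
      (auto simp: P.B_zero N.B_zero)
  hence "continuous_on {0..} (\<lambda>s. iterated_bm Xp Xm Y x s \<omega>)"
    unfolding Z by (rule continuous_on_compose2[OF _ Y.B_cont[OF True]]) auto
  from exit_time_gt_iff[OF this D t] show ?thesis using True by (simp add: survival_def Z)
qed (simp add: survival_def)

text \<open>Rational levels in place of the extrema of \<open>Y\<close> make measurability evident.\<close>

lemma survival_eq: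
  assumes t: "t \<ge> 0"
  shows "survival t = (\<Union>a\<in>\<rat> \<inter> {0..}. \<Union>b\<in>\<rat> \<inter> {0..}.
    P.survives D x a \<inter> N.survives D x b \<inter> Y.stays {-b..a} t)"
proof (rule set_eqI)
  fix \<omega>
  show "\<omega> \<in> survival t \<longleftrightarrow> \<omega> \<in> (\<Union>a\<in>\<rat> \<inter> {0..}. \<Union>b\<in>\<rat> \<inter> {0..}.
    P.survives D x a \<inter> N.survives D x b \<inter> Y.stays {-b..a} t)"
  proof (cases "\<omega> \<in> space M")
    case True
    have "\<omega> \<in> survival t \<longleftrightarrow> (\<exists>a\<in>\<rat> \<inter> {0..}. \<exists>b\<in>\<rat> \<inter> {0..}. (\<forall>s\<in>{0..t}. Y s \<omega> \<in> {-b..a}) \<and>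
       (\<forall>r\<in>{0..a}. x + Xp r \<omega> \<in> D) \<and> (\<forall>r\<in>{0..b}. x + Xm r \<omega> \<in> D))"
      unfolding survival_iff[OF t] using True t D
      by (subst two_sided_in_iff[symmetric])
         (auto intro!: continuous_intros P.B_cont N.B_cont Y.B_cont simp: P.B_zero N.B_zero Y.B_zero)
    also have "\<dots> \<longleftrightarrow> (\<exists>a\<in>\<rat> \<inter> {0..}. \<exists>b\<in>\<rat> \<inter> {0..}. \<omega> \<in> P.survives D x a \<inter> N.survives D x b \<inter> Y.stays {-b..a} t)"
      using True by (intro bex_cong refl) (auto simp: P.survives_iff[OF D] N.survives_iff[OF D] Y.stays_def)
    finally show ?thesis by simp
  qed (auto simp: survival_def Y.stays_def)
qed

lemma survivalI:
  assumes "t \<ge> 0" "a \<ge> 0" "b \<ge> 0" "\<omega> \<in> P.survives D x a" "\<omega> \<in> N.survives D x b" "\<omega> \<in> Y.stays {-b..a} t"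
  shows "\<omega> \<in> survival t"
  using assms(4-6) unfolding survival_iff[OF assms(1)] P.survives_iff[OF D assms(2)] N.survives_iff[OF D assms(3)] Y.stays_def
  by fastforce

lemma survival_sets: "t \<ge> 0 \<Longrightarrow> survival t \<in> sets M"
  unfolding survival_eq
  by (intro sets.countable_UN'' sets.Int countable_Int1 countable_rat
      subsetD[OF P.path_algebra_subset P.survives_path_algebra]
      subsetD[OF N.path_algebra_subset N.survives_path_algebra]
      subsetD[OF Y.path_algebra_subset Y.stays_path_algebra] D) auto

lemma survives_antimono:
  assumes "u \<le> v"
  shows "P.survives D x v \<subseteq> P.survives D x u" "N.survives D x v \<subseteq> N.survives D x u"
proof -
  have "ereal u \<le> ereal v" using assms by simp
  thus "P.survives D x v \<subseteq> P.survives D x u" "N.survives D x v \<subseteq> N.survives D x u"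
    unfolding P.survives_def N.survives_def by (auto intro: le_less_trans[of "ereal u" "ereal v"])
qed

text \<open>The survival event is covered by boxes in which the two extrema of \<open>Y\<close> lie
  in ranges i and k. The survival of \<open>Xp\<close> and \<open>Xm\<close> contributes weights
  \<open>w ^ i\<close> and \<open>w ^ k\<close>; after factorization one sum is the displayed one
  and the other is of order \<open>w ^ J\<close>.\<close>

lemma survival_upper:
  assumes p: "p > 0" and K: "K \<ge> 1"
    and Pb: "\<And>u. u \<ge> 1 \<Longrightarrow> P.prob (P.survives D x u) \<le> K * u powr (- p)"
    and Nb: "\<And>u. u \<ge> 1 \<Longrightarrow> P.prob (N.survives D x u) \<le> K * u powr (- p)"
  obtains C where "C > 0" "\<And>t J. t > 0 \<Longrightarrow> 2 ^ J \<le> sqrt t \<Longrightarrow> sqrt t \<le> 2 ^ Suc J \<Longrightarrow>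
    P.prob (survival t) \<le> C * ((2 powr (- p)) ^ J * (\<Sum>i\<le>J. (2 * 2 powr (- p)) ^ i) / sqrt t)"
proof -
  define w where "w = 2 powr (- p)"
  have w: "w > 0" "w < 1" using p by (auto simp: w_def powr_less_one)
  \<comment> \<open>\<open>N > p\<close> makes the sum over the larger of the two ranges geometric and dominated by its last term.\<close>
  obtain N :: nat where N: "real N \<ge> p + 1" using real_arch_simple by blast
  define c where "c = (6 * (3 * sqrt (real N)) ^ N + 6) * 2 ^ Suc N"
  have c: "c > 0" unfolding c_def by (intro mult_pos_pos add_nonneg_pos) auto
  define q where "q = w * 2 ^ N"
  have q: "q \<ge> 2"
  proof -
    have "q = 2 powr (real N - p)" by (simp add: q_def w_def powr_add[symmetric] powr_realpow[symmetric])
    also have "\<dots> \<ge> 2 powr 1" using N by (intro powr_mono) auto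
    finally show ?thesis by simp
  qed
  have qsum: "(\<Sum>k\<le>J. q ^ k) \<le> 2 * q ^ J" for J
  proof (induction J)
    case (Suc J)
    have "2 * q ^ J \<le> q * q ^ J" using q by (intro mult_right_mono) auto
    thus ?case using Suc by simp
  qed simp
  \<comment> \<open>\<open>\<beta> i\<close> is the lower end of range i: range 0 starts at 0, later
    ranges at \<open>2 ^ (i - 1)\<close>. The shift by one and the trivial bound for
    \<open>i = 0\<close> are both absorbed into \<open>K / w\<close>.\<close>
  define \<beta> where "\<beta> i = (if i = 0 then 0 else 2 ^ (i - 1) :: real)" for i :: nat
  have \<beta>0: "\<beta> i \<ge> 0" for i by (simp add: \<beta>_def)
  have Kw: "K / w \<ge> 1" using K w by (simp add: field_simps)
  have \<beta>: "P.prob (P.survives D x (\<beta> i)) \<le> K / w * w ^ i" "P.prob (N.survives D x (\<beta> i)) \<le> K / w * w ^ i" for i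
  proof -
    show "P.prob (P.survives D x (\<beta> i)) \<le> K / w * w ^ i"
    proof (cases i)
      case 0
      thus ?thesis using order_trans[OF P.prob_le_1 Kw] by simp
    next
      case (Suc j)
      have "P.prob (P.survives D x (2 ^ j)) \<le> K * (2 ^ j) powr (- p)" by (rule Pb) simp
      thus ?thesis using w by (simp add: \<beta>_def Suc two_power_powr w_def)
    qed
    show "P.prob (N.survives D x (\<beta> i)) \<le> K / w * w ^ i"
    proof (cases i)
      case 0
      thus ?thesis using order_trans[OF P.prob_le_1 Kw] by simp
    next
      case (Suc j)
      have "P.prob (N.survives D x (2 ^ j)) \<le> K * (2 ^ j) powr (- p)" by (rule Nb) simp
      thus ?thesis using w by (simp add: \<beta>_def Suc two_power_powr w_def)
    qed
  qed
  \<comment> \<open>One factor 2 counts the two orders of the extrema, the other comes from the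
    geometric sum.\<close>
  define C where "C = (K / w)\<^sup>2 * c * 4"
  show ?thesis
  proof (rule that[of C])
    show "C > 0" using K w c by (simp add: C_def)
    fix t :: real and J :: nat
    assume t: "t > 0" and J: "2 ^ J \<le> sqrt t" "sqrt t \<le> 2 ^ Suc J"
    define S where "S i k = (if k < J then {- (2 ^ k)..} else UNIV) \<inter> (if i < J then {..2 ^ i :: real} else UNIV)" for i k
    have clS: "closed (S i k)" for i k by (auto simp: S_def intro!: closed_Int)
    define E where "E i k = P.survives D x (\<beta> i) \<inter> N.survives D x (\<beta> k) \<inter> Y.stays (S i k) t" for i k
    have Em: "E i k \<in> sets M" for i k
      unfolding E_def using t
      by (intro sets.Int subsetD[OF P.path_algebra_subset P.survives_path_algebra]
          subsetD[OF N.path_algebra_subset N.survives_path_algebra]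
          subsetD[OF Y.path_algebra_subset Y.stays_path_algebra] D \<beta>0 clS) auto
    define \<phi> where "\<phi> i = 2 ^ i / sqrt t" for i :: nat
    have \<phi>: "\<phi> i \<ge> 0" for i using t by (simp add: \<phi>_def)
    have E: "P.prob (E i k) \<le> (K / w)\<^sup>2 * c * ((w ^ i * \<phi> i) * (w ^ k * \<phi> k ^ N) + (w ^ k * \<phi> k) * (w ^ i * \<phi> i ^ N))"
      if "i \<le> J" "k \<le> J" for i k
    proof -
      have "P.prob (E i k) = P.prob (P.survives D x (\<beta> i)) * P.prob (N.survives D x (\<beta> k)) * P.prob (Y.stays (S i k) t)"
        unfolding E_def using t
        by (intro prob_indep3 P.survives_path_algebra N.survives_path_algebra Y.stays_path_algebra D \<beta>0 clS) auto
      also have "\<dots> \<le> (K / w * w ^ i) * (K / w * w ^ k) * (c * (\<phi> i * \<phi> k ^ N + \<phi> k * \<phi> i ^ N))"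
      proof (intro mult_mono \<beta>)
        show "P.prob (Y.stays (S i k) t) \<le> c * (\<phi> i * \<phi> k ^ N + \<phi> k * \<phi> i ^ N)"
          unfolding S_def c_def \<phi>_def by (rule Y.dyadic_box_prob[OF t J(2) that])
      qed (use w K in auto)
      finally show ?thesis by (simp add: algebra_simps power2_eq_square)
    qed
    have cover: "survival t \<subseteq> (\<Union>(i, k)\<in>{..J} \<times> {..J}. E i k)"
    proof
      fix \<omega> assume "\<omega> \<in> survival t"
      then obtain a b where ab: "a \<ge> 0" "b \<ge> 0" "\<omega> \<in> P.survives D x a" "\<omega> \<in> N.survives D x b" "\<omega> \<in> Y.stays {-b..a} t"
        unfolding survival_eq[OF less_imp_le[OF t]] by auto
      \<comment> \<open>The disjunct \<open>i = J\<close> caps the index, so the last range is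
        unbounded. For \<open>i > 0\<close> minimality makes \<open>Y\<close> exceed
        \<open>2 ^ (i - 1)\<close> somewhere, hence \<open>\<beta> i \<le> a\<close>.\<close>
      define i where "i = (LEAST i. i = J \<or> (\<forall>s\<in>{0..t}. Y s \<omega> \<le> 2 ^ i))"
      define k where "k = (LEAST k. k = J \<or> (\<forall>s\<in>{0..t}. - Y s \<omega> \<le> 2 ^ k))"
      have i: "i = J \<or> (\<forall>s\<in>{0..t}. Y s \<omega> \<le> 2 ^ i)" "i \<le> J"
        unfolding i_def by (rule LeastI[of _ J], simp) (rule Least_le, simp)
      have k: "k = J \<or> (\<forall>s\<in>{0..t}. - Y s \<omega> \<le> 2 ^ k)" "k \<le> J"
        unfolding k_def by (rule LeastI[of _ J], simp) (rule Least_le, simp)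
      have "\<beta> i \<le> a"
      proof (cases i)
        case 0 thus ?thesis using ab by (simp add: \<beta>_def)
      next
        case (Suc j)
        hence "j < (LEAST i. i = J \<or> (\<forall>s\<in>{0..t}. Y s \<omega> \<le> 2 ^ i))" by (simp add: i_def)
        from not_less_Least[OF this] obtain s where "s \<in> {0..t}" "Y s \<omega> > 2 ^ j" by (auto simp: not_le)
        moreover from this have "Y s \<omega> \<le> a" using ab(5) unfolding Y.stays_def by fastforce
        ultimately show ?thesis by (simp add: \<beta>_def Suc)
      qed
      moreover have "\<beta> k \<le> b"
      proof (cases k)
        case 0 thus ?thesis using ab by (simp add: \<beta>_def)
      next
        case (Suc j)
        hence "j < (LEAST k. k = J \<or> (\<forall>s\<in>{0..t}. - Y s \<omega> \<le> 2 ^ k))" by (simp add: k_def)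
        from not_less_Least[OF this] obtain s where "s \<in> {0..t}" "- Y s \<omega> > 2 ^ j" by (auto simp: not_le)
        moreover from this have "- b \<le> Y s \<omega>" using ab(5) unfolding Y.stays_def by fastforce
        ultimately show ?thesis by (simp add: \<beta>_def Suc)
      qed
      moreover have "\<omega> \<in> Y.stays (S i k) t"
      proof -
        have "Y s \<omega> \<in> S i k" if s: "s \<in> {0..t}" for s
        proof -
          have "Y s \<omega> \<le> 2 ^ i" if "i < J" using i(1) s that by auto
          moreover have "- (2 ^ k) \<le> Y s \<omega>" if "k < J"
          proof -
            have "- Y s \<omega> \<le> 2 ^ k" using k(1) s that by blast
            thus ?thesis by linarith
          qed
          ultimately show ?thesis by (simp add: S_def)
        qed
        moreover have "\<omega> \<in> space M" using ab(5) by (simp add: Y.stays_def)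
        ultimately show ?thesis by (simp add: Y.stays_def)
      qed
      ultimately have "\<omega> \<in> E i k"
        unfolding E_def by (intro IntI subsetD[OF survives_antimono(1) ab(3)] subsetD[OF survives_antimono(2) ab(4)])
      thus "\<omega> \<in> (\<Union>(i, k)\<in>{..J} \<times> {..J}. E i k)" using i(2) k(2) by blast
    qed
    have "P.prob (survival t) \<le> P.prob (\<Union>(i, k)\<in>{..J} \<times> {..J}. E i k)"
      by (rule P.finite_measure_mono[OF cover]) (use Em in auto)
    also have "\<dots> \<le> (\<Sum>z\<in>{..J} \<times> {..J}. P.prob (case z of (i, k) \<Rightarrow> E i k))"
      by (rule measure_UNION_le) (use Em in auto)
    also have "\<dots> \<le> (\<Sum>(i, k)\<in>{..J} \<times> {..J}. (K / w)\<^sup>2 * c * ((w ^ i * \<phi> i) * (w ^ k * \<phi> k ^ N) + (w ^ k * \<phi> k) * (w ^ i * \<phi> i ^ N)))"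
      by (rule sum_mono) (use E in auto)
    also have "\<dots> = (K / w)\<^sup>2 * c * 2 * ((\<Sum>i\<le>J. w ^ i * \<phi> i) * (\<Sum>k\<le>J. w ^ k * \<phi> k ^ N))"
    proof -
      have dist: "(\<Sum>(i, k)\<in>I. a * (U i k + V i k)) = a * ((\<Sum>(i, k)\<in>I. U i k) + (\<Sum>(i, k)\<in>I. V i k))"
        for a :: real and U V :: "nat \<Rightarrow> nat \<Rightarrow> real" and I
        unfolding case_prod_unfold sum.distrib[symmetric] sum_distrib_left ..
      have 1: "(\<Sum>(i, k)\<in>{..J} \<times> {..J}. (w ^ i * \<phi> i) * (w ^ k * \<phi> k ^ N)) = (\<Sum>i\<le>J. w ^ i * \<phi> i) * (\<Sum>k\<le>J. w ^ k * \<phi> k ^ N)"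
        by (simp only: sum_product sum.cartesian_product)
      have 2: "(\<Sum>(i, k)\<in>{..J} \<times> {..J}. (w ^ k * \<phi> k) * (w ^ i * \<phi> i ^ N)) = (\<Sum>k\<le>J. w ^ k * \<phi> k ^ N) * (\<Sum>i\<le>J. w ^ i * \<phi> i)"
        unfolding sum_product sum.cartesian_product by (rule sum.cong) (auto simp: mult.commute)
      show ?thesis unfolding dist 1 2 by simp
    qed
    \<comment> \<open>The second sum is geometric with ratio \<open>q \<ge> 2\<close>, hence at most
      twice its last term; \<open>sqrt t \<ge> 2 ^ J\<close> and
      \<open>q ^ J = w ^ J * (2 ^ J) ^ N\<close> leave \<open>w ^ J\<close>.\<close>
    also have "\<dots> \<le> (K / w)\<^sup>2 * c * 2 * ((\<Sum>i\<le>J. w ^ i * \<phi> i) * (2 * w ^ J))"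
    proof (intro mult_left_mono)
      have "(\<Sum>k\<le>J. w ^ k * \<phi> k ^ N) = (\<Sum>k\<le>J. q ^ k) / sqrt t ^ N"
        unfolding sum_divide_distrib
        by (rule sum.cong) (auto simp: q_def \<phi>_def power_mult_distrib power_divide power_mult[symmetric] mult.commute)
      also have "\<dots> \<le> (\<Sum>k\<le>J. q ^ k) / (2 ^ J) ^ N"
        using J t q by (intro divide_left_mono power_mono sum_nonneg mult_pos_pos) auto
      also have "\<dots> \<le> 2 * q ^ J / (2 ^ J) ^ N" by (intro divide_right_mono qsum) auto
      also have "\<dots> = 2 * w ^ J"
        by (simp add: q_def power_mult_distrib power_mult[symmetric] mult.commute)
      finally show "(\<Sum>k\<le>J. w ^ k * \<phi> k ^ N) \<le> 2 * w ^ J" .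
    qed (use c w \<phi> in \<open>auto intro!: sum_nonneg\<close>)
    also have "(\<Sum>i\<le>J. w ^ i * \<phi> i) = (\<Sum>i\<le>J. (2 * w) ^ i) / sqrt t"
      unfolding sum_divide_distrib by (rule sum.cong) (auto simp: \<phi>_def power_mult_distrib)
    finally show "P.prob (survival t) \<le> C * ((2 powr (- p)) ^ J * (\<Sum>i\<le>J. (2 * 2 powr (- p)) ^ i) / sqrt t)"
      unfolding w_def[symmetric] by (simp add: C_def mult_ac)
  qed
qed

text \<open>\<open>Xm\<close> is made to survive up to the fixed level \<open>12 * sqrt t\<close>,
  and the paths of \<open>Y\<close> above \<open>- 12 * sqrt t\<close> are split into disjoint
  shells by their maximum. Only the total probability of the first shells is bounded below, which is
  why \<open>abel_geometric\<close> enters.\<close>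

lemma survival_lower:
  assumes p: "p > 0" and c: "c > 0"
    and Pb: "\<And>u. u \<ge> 1 \<Longrightarrow> c * u powr (- p) \<le> P.prob (P.survives D x u)"
    and Nb: "\<And>u. u \<ge> 1 \<Longrightarrow> c * u powr (- p) \<le> P.prob (N.survives D x u)"
  obtains C where "C > 0" "\<And>t J. t > 0 \<Longrightarrow> 2 ^ J \<le> sqrt t \<Longrightarrow> sqrt t \<le> 2 ^ Suc J \<Longrightarrow>
    C * ((2 powr (- p)) ^ J * (\<Sum>i\<le>J. (2 * 2 powr (- p)) ^ i) / sqrt t) \<le> P.prob (survival t)"
proof -
  define w where "w = 2 powr (- p)"
  have w: "w > 0" "w < 1" using p by (auto simp: w_def powr_less_one)
  \<comment> \<open>The number 24 comes from \<open>12 * sqrt t \<le> 24 * 2 ^ J\<close>, the factor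
    \<open>1 - w\<close> from summation by parts, and the 6 from \<open>stays_lower\<close>.\<close>
  define C where "C = c * (c * 24 powr (- p)) * ((1 - w) / 6)"
  show ?thesis
  proof (rule that[of C])
    show "C > 0" using c w by (simp add: C_def)
    fix t :: real and J :: nat
    assume t: "t > 0" and J: "2 ^ J \<le> sqrt t" "sqrt t \<le> 2 ^ Suc J"
    define L where "L = 12 * sqrt t"
    have "(1 :: real) \<le> 2 ^ J" by simp
    hence L: "L \<ge> 1" unfolding L_def using J(1) by linarith
    have NL: "c * 24 powr (- p) * w ^ J \<le> P.prob (N.survives D x L)"
    proof -
      have "24 powr (- p) * w ^ J = (24 * 2 ^ J) powr (- p)" by (simp add: powr_mult two_power_powr w_def)
      also have "\<dots> \<le> L powr (- p)" using J L p t by (intro powr_mono2') (auto simp: L_def)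
      finally have "c * (24 powr (- p) * w ^ J) \<le> c * L powr (- p)" using c by (intro mult_left_mono) auto
      thus ?thesis using Nb[OF L] by simp
    qed
    define A where "A j = Y.stays {-L..2 ^ j} t" for j :: nat
    \<comment> \<open>On \<open>R j\<close> the maximum of \<open>Y\<close> is at most
      \<open>2 ^ j\<close>, so survival of \<open>Xp\<close> up to that level suffices; disjointness
      lets the contributions be added.\<close>
    define R where "R = disjointed A"
    have Ap: "A j \<in> sets Y.path_algebra" for j
      unfolding A_def using t by (intro Y.stays_path_algebra) auto
    have Rp: "R j \<in> sets Y.path_algebra" for j
      unfolding R_def disjointed_def using Ap by auto
    have RA: "R j \<subseteq> A j" for j unfolding R_def by (rule disjointed_subset)
    have disj: "disjoint_family R" unfolding R_def by (rule disjoint_family_disjointed)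
    define f where "f j = P.prob (R j)" for j
    have f: "(\<Sum>j\<le>i. f j) \<ge> 2 ^ i / (6 * sqrt t)" if "i \<le> J" for i
    proof -
      have "2 ^ i \<le> (2 :: real) ^ J" using that by simp
      hence it: "2 ^ i \<le> sqrt t" using J(1) by linarith
      have "2 ^ i / (6 * sqrt t) \<le> P.prob (A i)"
        unfolding A_def L_def by (rule Y.stays_lower[OF t _ it]) simp
      also have "\<dots> \<le> P.prob (\<Union>j\<in>{..i}. R j)"
      proof (rule P.finite_measure_mono)
        have "A i \<subseteq> (\<Union>j\<in>{0..<Suc i}. A j)" by auto
        also have "\<dots> = (\<Union>j\<in>{0..<Suc i}. R j)" unfolding R_def by (rule finite_UN_disjointed_eq[symmetric])
        also have "{0..<Suc i} = {..i}" by auto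
        finally show "A i \<subseteq> (\<Union>j\<in>{..i}. R j)" .
        show "(\<Union>j\<in>{..i}. R j) \<in> sets M"
          by (intro sets.finite_UN subsetD[OF Y.path_algebra_subset Rp]) auto
      qed
      also have "\<dots> = (\<Sum>j\<le>i. f j)"
        unfolding f_def using disj subsetD[OF Y.path_algebra_subset Rp]
        by (intro P.finite_measure_finite_Union) (auto simp: disjoint_family_on_def)
      finally show ?thesis .
    qed
    have f0: "f j \<ge> 0" for j by (simp add: f_def)
    define G where "G j = P.survives D x (2 ^ j) \<inter> N.survives D x L \<inter> R j" for j :: nat
    have Gm: "G j \<in> sets M" for j
      unfolding G_def using L
      by (intro sets.Int subsetD[OF P.path_algebra_subset P.survives_path_algebra]
          subsetD[OF N.path_algebra_subset N.survives_path_algebra]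
          subsetD[OF Y.path_algebra_subset Rp] D) auto
    have G: "P.prob (G j) \<ge> c * w ^ j * (c * 24 powr (- p) * w ^ J) * f j" for j
    proof -
      have "P.prob (G j) = P.prob (P.survives D x (2 ^ j)) * P.prob (N.survives D x L) * f j"
        unfolding G_def f_def using L
        by (intro prob_indep3 P.survives_path_algebra N.survives_path_algebra Rp D) auto
      moreover have "c * w ^ j \<le> P.prob (P.survives D x (2 ^ j))"
        using Pb[of "2 ^ j"] by (simp add: two_power_powr w_def)
      hence "c * w ^ j * (c * 24 powr (- p) * w ^ J) * f j \<le>
          P.prob (P.survives D x (2 ^ j)) * P.prob (N.survives D x L) * f j"
        using NL c w f0 by (intro mult_right_mono mult_mono) auto
      ultimately show ?thesis by simp
    qed
    have "(\<Sum>i\<le>J. (2 * w) ^ i) * (1 / (6 * sqrt t)) = (\<Sum>i\<le>J. w ^ i * (2 ^ i / (6 * sqrt t)))"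
      unfolding sum_distrib_right by (rule sum.cong) (auto simp: power_mult_distrib)
    also have "\<dots> \<le> (\<Sum>i\<le>J. w ^ i * (\<Sum>j\<le>i. f j))"
      using f w by (intro sum_mono mult_left_mono) auto
    finally have "(1 - w) * ((\<Sum>i\<le>J. (2 * w) ^ i) * (1 / (6 * sqrt t))) \<le> (1 - w) * (\<Sum>i\<le>J. w ^ i * (\<Sum>j\<le>i. f j))"
      using w by (intro mult_left_mono) auto
    \<comment> \<open>The boundary term of the summation by parts is nonnegative and is
      dropped.\<close>
    also have "\<dots> \<le> (\<Sum>j\<le>J. f j * w ^ j)"
      unfolding abel_geometric[symmetric] using w f0 by (simp add: sum_nonneg)
    finally have ab: "(1 - w) * ((\<Sum>i\<le>J. (2 * w) ^ i) * (1 / (6 * sqrt t))) \<le> (\<Sum>j\<le>J. f j * w ^ j)" .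
    have "C * (w ^ J * (\<Sum>i\<le>J. (2 * w) ^ i) / sqrt t) =
        c * (c * 24 powr (- p) * w ^ J) * ((1 - w) * ((\<Sum>i\<le>J. (2 * w) ^ i) * (1 / (6 * sqrt t))))"
      by (simp add: C_def)
    also have "\<dots> \<le> c * (c * 24 powr (- p) * w ^ J) * (\<Sum>j\<le>J. f j * w ^ j)"
      using ab c w by (intro mult_left_mono) auto
    also have "\<dots> = (\<Sum>j\<le>J. c * w ^ j * (c * 24 powr (- p) * w ^ J) * f j)"
      unfolding sum_distrib_left by (rule sum.cong) auto
    also have "\<dots> \<le> (\<Sum>j\<le>J. P.prob (G j))" by (intro sum_mono G)
    also have "\<dots> = P.prob (\<Union>j\<in>{..J}. G j)"
      using disj Gm by (intro P.finite_measure_finite_Union[symmetric]) (auto simp: disjoint_family_on_def G_def)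
    also have "\<dots> \<le> P.prob (survival t)"
    proof (rule P.finite_measure_mono)
      show "survival t \<in> sets M" using t by (intro survival_sets) auto
      show "(\<Union>j\<in>{..J}. G j) \<subseteq> survival t"
      proof
        fix \<omega> assume "\<omega> \<in> (\<Union>j\<in>{..J}. G j)"
        then obtain j where "\<omega> \<in> G j" by blast
        hence "\<omega> \<in> P.survives D x (2 ^ j)" "\<omega> \<in> N.survives D x L" "\<omega> \<in> Y.stays {-L..2 ^ j} t"
          using RA[of j] by (auto simp: G_def A_def)
        thus "\<omega> \<in> survival t" using t L by (intro survivalI) auto
      qed
    qed
    finally show "C * ((2 powr (- p)) ^ J * (\<Sum>i\<le>J. (2 * 2 powr (- p)) ^ i) / sqrt t) \<le> P.prob (survival t)"
      unfolding w_def[symmetric] .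
  qed
qed

end

section \<open>The three regimes\<close>

lemma dyadic_bracket:
  assumes "s \<ge> (1 :: real)"
  obtains J where "2 ^ J \<le> s" "s \<le> 2 ^ Suc J"
proof -
  obtain n where n: "s < 2 ^ n" using real_arch_pow[of 2 s] by auto
  define m where "m = (LEAST n. s < 2 ^ n)"
  have m: "s < 2 ^ m" unfolding m_def by (rule LeastI[of _ n]) (rule n)
  have "m \<noteq> 0" using m assms by (intro notI) simp
  then obtain J where J: "m = Suc J" using not0_implies_Suc by blast
  have "\<not> s < 2 ^ J" using not_less_Least[of J "\<lambda>n. s < 2 ^ n"] J m_def by simp
  thus ?thesis using m J by (intro that[of J]) auto
qed

context
  fixes p t :: real and J :: nat
  assumes p: "p > 0" and t: "t > 0" and J: "2 ^ J \<le> sqrt t" "sqrt t \<le> 2 ^ Suc J"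
begin

lemma dyadic_weight_bounds:
  "t powr (- p / 2) \<le> (2 powr (- p)) ^ J" "(2 powr (- p)) ^ J \<le> 2 powr p * t powr (- p / 2)"
proof -
  have s: "sqrt t powr (- p) = t powr (- p / 2)"
    using t by (simp add: powr_half_sqrt[symmetric] powr_powr)
  have "sqrt t powr (- p) \<le> (2 ^ J) powr (- p)" using J p by (intro powr_mono2') auto
  thus "t powr (- p / 2) \<le> (2 powr (- p)) ^ J" by (simp add: s two_power_powr)
  have "(2 ^ Suc J) powr (- p) \<le> sqrt t powr (- p)" using J p t by (intro powr_mono2') auto
  hence "2 powr (- p) * (2 powr (- p)) ^ J \<le> t powr (- p / 2)" unfolding two_power_powr s by simp
  hence "2 powr p * (2 powr (- p) * (2 powr (- p)) ^ J) \<le> 2 powr p * t powr (- p / 2)"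
    by (intro mult_left_mono) auto
  thus "(2 powr (- p)) ^ J \<le> 2 powr p * t powr (- p / 2)"
    by (simp add: mult.assoc[symmetric] powr_add[symmetric])
qed

text \<open>The ratio \<open>2 powr (1 - p)\<close> is below one, so the sum is bounded between 1
  and its full geometric series; the order is that of the prefactor.\<close>

lemma dyadic_sum_gt_1:
  assumes "p > 1"
  shows "t powr (- (p + 1) / 2) \<le> (2 powr (- p)) ^ J * (\<Sum>i\<le>J. (2 * 2 powr (- p)) ^ i) / sqrt t"
    "(2 powr (- p)) ^ J * (\<Sum>i\<le>J. (2 * 2 powr (- p)) ^ i) / sqrt t
       \<le> 2 powr p / (1 - 2 * 2 powr (- p)) * t powr (- (p + 1) / 2)"
proof -
  define r where "r = 2 * 2 powr (- p)"
  have r: "0 < r" "r < 1"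
  proof -
    have "r = 2 powr (1 - p)" by (simp add: r_def powr_diff powr_minus divide_inverse)
    thus "r < 1" using assms by (simp add: powr_less_one)
  qed (simp add: r_def)
  have sum: "1 \<le> (\<Sum>i\<le>J. r ^ i)" "(\<Sum>i\<le>J. r ^ i) \<le> 1 / (1 - r)"
  proof -
    show "1 \<le> (\<Sum>i\<le>J. r ^ i)" using member_le_sum[of 0 "{..J}" "\<lambda>i. r ^ i"] r by simp
    have "(\<Sum>i<Suc J. r ^ i) = (1 - r ^ Suc J) / (1 - r)" using r sum_gp_strict[of r "Suc J"] by simp
    also have "\<dots> \<le> 1 / (1 - r)" using r by (intro divide_right_mono) auto
    finally show "(\<Sum>i\<le>J. r ^ i) \<le> 1 / (1 - r)" by (simp only: lessThan_Suc_atMost)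
  qed
  have tp: "t powr (- (p + 1) / 2) = t powr (- p / 2) / sqrt t"
    using t by (simp add: powr_half_sqrt[symmetric] powr_diff[symmetric] diff_divide_distrib)
  have "t powr (- p / 2) * 1 \<le> (2 powr (- p)) ^ J * (\<Sum>i\<le>J. r ^ i)"
    using dyadic_weight_bounds sum by (intro mult_mono) auto
  thus "t powr (- (p + 1) / 2) \<le> (2 powr (- p)) ^ J * (\<Sum>i\<le>J. (2 * 2 powr (- p)) ^ i) / sqrt t"
    unfolding tp r_def[symmetric] using t by (intro divide_right_mono) auto
  have "(2 powr (- p)) ^ J * (\<Sum>i\<le>J. r ^ i) \<le> (2 powr p * t powr (- p / 2)) * (1 / (1 - r))"
    using dyadic_weight_bounds sum r by (intro mult_mono sum_nonneg) auto
  hence "(2 powr (- p)) ^ J * (\<Sum>i\<le>J. r ^ i) / sqrt t \<le> (2 powr p * t powr (- p / 2)) * (1 / (1 - r)) / sqrt t"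
    using t by (intro divide_right_mono) auto
  thus "(2 powr (- p)) ^ J * (\<Sum>i\<le>J. (2 * 2 powr (- p)) ^ i) / sqrt t
       \<le> 2 powr p / (1 - 2 * 2 powr (- p)) * t powr (- (p + 1) / 2)"
    unfolding tp r_def[symmetric] by simp
qed

text \<open>The ratio exceeds one, so the sum is comparable to its last term
  \<open>2 ^ J * w ^ J\<close>. The factor \<open>2 ^ J\<close> balances \<open>sqrt t\<close>, and
  the two weights \<open>w ^ J\<close> combine to order \<open>t powr (- p)\<close>.\<close>

lemma dyadic_sum_lt_1:
  assumes "p < 1"
  shows "1 / 2 * t powr (- p) \<le> (2 powr (- p)) ^ J * (\<Sum>i\<le>J. (2 * 2 powr (- p)) ^ i) / sqrt t"
    "(2 powr (- p)) ^ J * (\<Sum>i\<le>J. (2 * 2 powr (- p)) ^ i) / sqrt t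
       \<le> (2 powr p)\<^sup>2 * (2 * 2 powr (- p) / (2 * 2 powr (- p) - 1)) * t powr (- p)"
proof -
  define r where "r = 2 * 2 powr (- p)"
  define w where "w = 2 powr (- p)"
  have r: "1 < r"
  proof -
    have "r = 2 powr (1 - p)" by (simp add: r_def powr_diff powr_minus divide_inverse)
    also have "\<dots> > 2 powr 0" using assms by (intro powr_less_mono) auto
    finally show ?thesis by simp
  qed
  have w: "w > 0" by (simp add: w_def)
  have rw: "r ^ J = 2 ^ J * w ^ J" by (simp add: r_def w_def power_mult_distrib)
  have sum: "r ^ J \<le> (\<Sum>i\<le>J. r ^ i)" "(\<Sum>i\<le>J. r ^ i) \<le> r / (r - 1) * r ^ J"
  proof -
    show "r ^ J \<le> (\<Sum>i\<le>J. r ^ i)" using r by (intro member_le_sum) auto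
    have "(\<Sum>i<Suc J. r ^ i) = (1 - r ^ Suc J) / (1 - r)" using r sum_gp_strict[of r "Suc J"] by simp
    also have "\<dots> = (r ^ Suc J - 1) / (r - 1)" using minus_divide_divide[of "r ^ Suc J - 1" "r - 1"] by simp
    also have "\<dots> \<le> r ^ Suc J / (r - 1)" using r by (intro divide_right_mono) auto
    finally show "(\<Sum>i\<le>J. r ^ i) \<le> r / (r - 1) * r ^ J" by (simp only: lessThan_Suc_atMost) simp
  qed
  have tp: "t powr (- p) = (t powr (- p / 2))\<^sup>2"
    using t by (simp add: power2_eq_square powr_add[symmetric])
  have b: "t powr (- p / 2) \<le> w ^ J" "w ^ J \<le> 2 powr p * t powr (- p / 2)"
    using dyadic_weight_bounds by (simp_all add: w_def)
  have b1: "t powr (- p) \<le> (w ^ J)\<^sup>2" unfolding tp by (rule power_mono[OF b(1)]) simp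
  have b2: "(w ^ J)\<^sup>2 \<le> (2 powr p)\<^sup>2 * t powr (- p)"
    unfolding tp power_mult_distrib[symmetric] using w by (intro power_mono[OF b(2)]) auto
  have q: "1 / 2 \<le> 2 ^ J / sqrt t" "2 ^ J / sqrt t \<le> 1" using J t by (auto simp: field_simps)
  have "1 / 2 * t powr (- p) \<le> 2 ^ J / sqrt t * (w ^ J)\<^sup>2" using b1 q t by (intro mult_mono) auto
  also have "\<dots> = w ^ J * r ^ J / sqrt t" by (simp add: rw power2_eq_square)
  also have "\<dots> \<le> w ^ J * (\<Sum>i\<le>J. r ^ i) / sqrt t"
    using sum(1) w t by (intro divide_right_mono mult_left_mono) auto
  finally show "1 / 2 * t powr (- p) \<le> (2 powr (- p)) ^ J * (\<Sum>i\<le>J. (2 * 2 powr (- p)) ^ i) / sqrt t"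
    by (simp only: w_def r_def)
  have "w ^ J * (\<Sum>i\<le>J. r ^ i) / sqrt t \<le> w ^ J * (r / (r - 1) * r ^ J) / sqrt t"
    using sum(2) w t by (intro divide_right_mono mult_left_mono) auto
  also have "\<dots> = (2 ^ J / sqrt t) * ((w ^ J)\<^sup>2 * (r / (r - 1)))" by (simp add: rw power2_eq_square mult_ac)
  also have "\<dots> \<le> 1 * ((2 powr p)\<^sup>2 * t powr (- p) * (r / (r - 1)))"
    using q(2) b2 r w by (intro mult_mono mult_right_mono) auto
  finally show "(2 powr (- p)) ^ J * (\<Sum>i\<le>J. (2 * 2 powr (- p)) ^ i) / sqrt t
       \<le> (2 powr p)\<^sup>2 * (2 * 2 powr (- p) / (2 * 2 powr (- p) - 1)) * t powr (- p)"
    unfolding w_def r_def by (simp only: mult_1 mult_ac)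
qed

text \<open>All \<open>J + 1\<close> terms equal one, and \<open>J + 1\<close> is comparable to
  \<open>ln t\<close> because \<open>2 ^ J\<close> is comparable to \<open>sqrt t\<close>.\<close>

lemma dyadic_sum_eq_1:
  assumes "p = 1" and t4: "t \<ge> 4"
  shows "1 / (2 * ln 2) * (ln t / t) \<le> (2 powr (- p)) ^ J * (\<Sum>i\<le>J. (2 * 2 powr (- p)) ^ i) / sqrt t"
    "(2 powr (- p)) ^ J * (\<Sum>i\<le>J. (2 * 2 powr (- p)) ^ i) / sqrt t \<le> 2 / ln 2 * (ln t / t)"
proof -
  have w: "2 * 2 powr (- p) = 1" using assms by (simp add: powr_minus)
  have e: "(2 powr (- p)) ^ J * (\<Sum>i\<le>J. (2 * 2 powr (- p)) ^ i) / sqrt t = (real J + 1) / (2 ^ J * sqrt t)"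
    unfolding w using assms by (simp add: powr_minus power_inverse divide_simps)
  have tt: "t = sqrt t * sqrt t" using t by simp
  have ln2: "ln (2 :: real) > 0" by simp
  have lnt: "ln t = 2 * ln (sqrt t)" using t by (simp add: ln_sqrt)
  have l1: "real J * ln 2 \<le> ln (sqrt t)"
    using ln_mono[OF J(1)] t by (simp add: ln_realpow)
  have l2: "ln (sqrt t) \<le> (real J + 1) * ln 2"
  proof -
    have "ln (sqrt t) \<le> ln (2 ^ Suc J)" using t J(2) by (intro ln_mono) auto
    also have "\<dots> = real (Suc J) * ln 2" by (rule ln_realpow)
    finally show ?thesis by (simp add: add.commute)
  qed
  \<comment> \<open>For \<open>t \<ge> 4\<close> one has \<open>ln 2 \<le> ln (sqrt t)\<close>,
    which absorbs the summand 1 in \<open>J + 1\<close>.\<close>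
  have "2 \<le> sqrt t" using t4 by (intro real_le_rsqrt) auto
  hence "ln 2 \<le> ln (sqrt t)" by (intro ln_mono) auto
  hence l3: "(real J + 1) * ln 2 \<le> ln t" using l1 lnt by (simp add: algebra_simps)
  have "ln t / (2 * ln 2) \<le> real J + 1" using l2 lnt ln2 by (simp add: field_simps)
  hence "ln t / (2 * ln 2) / t \<le> (real J + 1) / t" using t by (intro divide_right_mono) auto
  also have "\<dots> \<le> (real J + 1) / (2 ^ J * sqrt t)"
    using J(1) t by (subst tt, intro divide_left_mono mult_right_mono) auto
  finally show "1 / (2 * ln 2) * (ln t / t) \<le> (2 powr (- p)) ^ J * (\<Sum>i\<le>J. (2 * 2 powr (- p)) ^ i) / sqrt t"
    unfolding e by simp
  have "(real J + 1) / (2 ^ J * sqrt t) \<le> (real J + 1) / (t / 2)"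
  proof (rule divide_left_mono)
    have "sqrt t * sqrt t \<le> (2 * 2 ^ J) * sqrt t" using J(2) t by (intro mult_right_mono) auto
    thus "t / 2 \<le> 2 ^ J * sqrt t" using tt by simp
  qed (use t in auto)
  also have "\<dots> \<le> (ln t / ln 2) / (t / 2)"
    using l3 ln2 t by (intro divide_right_mono) (auto simp: field_simps)
  finally show "(2 powr (- p)) ^ J * (\<Sum>i\<le>J. (2 * 2 powr (- p)) ^ i) / sqrt t \<le> 2 / ln 2 * (ln t / t)"
    unfolding e by (simp add: mult.commute)
qed

end

lemma approx_at_topI:
  assumes "0 < c" "0 < C" and "\<And>t. t \<ge> T \<Longrightarrow> c * g t \<le> f t \<and> f t \<le> C * g t \<and> g t > (0 :: real)"
  shows "approx_at_top f g"
proof -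
  have "c \<le> f t / g t \<and> f t / g t \<le> C" if "t \<ge> T" for t
    using assms(3)[OF that] by (simp add: pos_le_divide_eq pos_divide_le_eq)
  moreover from this[of T] have "c \<le> C" by linarith
  ultimately show ?thesis unfolding approx_at_top_def using assms(1)
    by (intro exI[of _ c] exI[of _ C] conjI) (auto simp: eventually_at_top_linorder)
qed

theorem theorem1p3:
  fixes M :: "'w measure"
    and Xp Xm :: "real \<Rightarrow> 'w \<Rightarrow> real^'n"
    and Y :: "real \<Rightarrow> 'w \<Rightarrow> real"
    and D :: "(real^'n) set" and p :: real and x :: "real^'n"
  assumes "generalized_cone D"
    and "brownian_motion M Xp" and "brownian_motion M Xm" and "brownian_motion M Y"
    and "indep3 M Xp Xm Y"
    and "p > 0"
    and "\<forall>y\<in>D. \<exists>C>0. (\<lambda>t. measure M {\<omega> \<in> space M. exit_time D (\<lambda>s. y + Xp s \<omega>) > ereal t})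
                        \<sim>[at_top] (\<lambda>t. C * t powr (- p))"
    and "x \<in> D"
  shows "(p < 1 \<longrightarrow> approx_at_top
             (\<lambda>t. measure M {\<omega> \<in> space M. exit_time D (\<lambda>s. iterated_bm Xp Xm Y x s \<omega>) > ereal t})
             (\<lambda>t. t powr (- p)))
       \<and> (p = 1 \<longrightarrow> approx_at_top
             (\<lambda>t. measure M {\<omega> \<in> space M. exit_time D (\<lambda>s. iterated_bm Xp Xm Y x s \<omega>) > ereal t})
             (\<lambda>t. ln t / t))
       \<and> (p > 1 \<longrightarrow> approx_at_top
             (\<lambda>t. measure M {\<omega> \<in> space M. exit_time D (\<lambda>s. iterated_bm Xp Xm Y x s \<omega>) > ereal t})
             (\<lambda>t. t powr (- (p + 1) / 2)))"
proof -
  have D: "open D" using assms(1) by (simp add: generalized_cone_def open_cone_vertex0_def)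
  interpret P: brownian M Xp by (rule brownianI[OF assms(2)])
  interpret N: brownian M Xm by (rule brownianI[OF assms(3)])
  interpret Y: real_brownian M Y by (simp add: real_brownian_def brownianI[OF assms(4)])
  interpret I: iterated_brownian M Xp Xm Y D x by unfold_locales (rule assms(5), rule D)
  note p = \<open>p > 0\<close>
  let ?f = "\<lambda>t. measure M {\<omega> \<in> space M. exit_time D (\<lambda>s. iterated_bm Xp Xm Y x s \<omega>) > ereal t}"
  let ?Q = "\<lambda>t J. (2 powr (- p)) ^ J * (\<Sum>i\<le>J. (2 * 2 powr (- p)) ^ i) / sqrt t"
  have f: "?f t = P.prob (I.survival t)" for t by (simp add: I.survival_def)
  obtain C where C: "C > 0" "(\<lambda>t. P.prob (P.survives D x t)) \<sim>[at_top] (\<lambda>t. C * t powr (- p))"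
    using assms(7,8) unfolding P.survives_def by blast
  obtain c K where c: "c > 0" and K: "K \<ge> 1"
    and lo: "\<And>u. u \<ge> 1 \<Longrightarrow> c * u powr (- p) \<le> P.prob (P.survives D x u)"
    and up: "\<And>u. u \<ge> 1 \<Longrightarrow> P.prob (P.survives D x u) \<le> K * u powr (- p)"
  proof (rule survival_power_bounds[OF C(2,1) _ _ p])
    fix u v :: real assume "0 \<le> u" "u \<le> v"
    thus "P.prob (P.survives D x v) \<le> P.prob (P.survives D x u)"
      by (intro P.finite_measure_mono I.survives_antimono
          subsetD[OF P.path_algebra_subset P.survives_path_algebra] D)
  qed (use P.prob_le_1 in blast)+
  \<comment> \<open>The decay is assumed for \<open>Xp\<close>; equality in law provides the same
    bounds for \<open>Xm\<close>.\<close>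
  have eq: "P.prob (N.survives D x u) = P.prob (P.survives D x u)" if "u \<ge> 1" for u
    using that by (intro survives_law_eq N.brownian_axioms P.brownian_axioms D) auto
  obtain A where A: "A > 0" "\<And>t J. t > 0 \<Longrightarrow> 2 ^ J \<le> sqrt t \<Longrightarrow> sqrt t \<le> 2 ^ Suc J \<Longrightarrow> P.prob (I.survival t) \<le> A * ?Q t J"
    using I.survival_upper[OF p K up] eq up by metis
  obtain B where B: "B > 0" "\<And>t J. t > 0 \<Longrightarrow> 2 ^ J \<le> sqrt t \<Longrightarrow> sqrt t \<le> 2 ^ Suc J \<Longrightarrow> B * ?Q t J \<le> P.prob (I.survival t)"
    using I.survival_lower[OF p c lo] eq lo by metis
  have approx: "approx_at_top ?f g"
    if ab: "a > 0" "b > 0"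
      and Q: "\<And>t J. t \<ge> 4 \<Longrightarrow> 2 ^ J \<le> sqrt t \<Longrightarrow> sqrt t \<le> 2 ^ Suc J \<Longrightarrow> a * g t \<le> ?Q t J \<and> ?Q t J \<le> b * g t"
      and g: "\<And>t. t \<ge> 4 \<Longrightarrow> g t > 0"
    for a b g
  \<comment> \<open>The threshold 4 is dictated by the logarithmic case; it also ensures
    \<open>sqrt t \<ge> 1\<close>, so that a suitable J exists.\<close>
  proof (rule approx_at_topI[of "B * a" "A * b" 4])
    fix t :: real assume t: "t \<ge> 4"
    hence "sqrt t \<ge> 1" by simp
    then obtain J where J: "2 ^ J \<le> sqrt t" "sqrt t \<le> 2 ^ Suc J" by (rule dyadic_bracket)
    have t0: "t > 0" using t by simp
    have q: "a * g t \<le> ?Q t J" "?Q t J \<le> b * g t" using Q[OF t J] by auto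
    have "B * (a * g t) \<le> ?f t"
      unfolding f using mult_left_mono[OF q(1), of B] B(2)[OF t0 J] B(1) by linarith
    moreover have "?f t \<le> A * (b * g t)"
      unfolding f using mult_left_mono[OF q(2), of A] A(2)[OF t0 J] A(1) by linarith
    ultimately show "B * a * g t \<le> ?f t \<and> ?f t \<le> A * b * g t \<and> 0 < g t"
      using g[OF t] by (simp only: mult.assoc)
  qed (use ab A B in auto)
  show ?thesis
  proof (intro conjI impI)
    assume p1: "p < 1"
    have "2 powr 0 < (2 :: real) powr (1 - p)" using p1 by (intro powr_less_mono) auto
    hence r: "2 * 2 powr (- p) > 1" by (simp add: powr_diff powr_minus divide_inverse)
    show "approx_at_top ?f (\<lambda>t. t powr (- p))"
      by (rule approx[of "1 / 2" "(2 powr p)\<^sup>2 * (2 * 2 powr (- p) / (2 * 2 powr (- p) - 1))"])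
         (use dyadic_sum_lt_1[OF p _ _ _ p1] r in auto)
  next
    assume p1: "p = 1"
    show "approx_at_top ?f (\<lambda>t. ln t / t)"
      by (rule approx[of "1 / (2 * ln 2)" "2 / ln 2"])
         (use dyadic_sum_eq_1[OF p _ _ _ p1] in auto)
  next
    assume p1: "p > 1"
    have "(2 :: real) powr (1 - p) < 2 powr 0" using p1 by (intro powr_less_mono) auto
    hence r: "2 * 2 powr (- p) < 1" by (simp add: powr_diff powr_minus divide_inverse)
    show "approx_at_top ?f (\<lambda>t. t powr (- (p + 1) / 2))"
      by (rule approx[of 1 "2 powr p / (1 - 2 * 2 powr (- p))"])
         (use dyadic_sum_gt_1[OF p _ _ _ p1] r in auto)
  qed
qed

end
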